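(* Let $(\mathcal{A},\bullet,\omega)$ be a pre-symplectic left-symmetric algebra over $\mathbb{R}$ such that the commutator ideal $[\mathcal{A},\mathcal{A}]$ is degenerate with respect to $\omega$. Then there exists a totally isotropic two-sided ideal $I\subseteq[\mathcal{A},\mathcal{A}]\cap[\mathcal{A},\mathcal{A}]^\perp$ of $(\mathcal{A},\bullet)$ of dimension $1$ or $2$. Moreover, $(\mathcal{A},\bullet,\omega)$ is either a double extension of $(\mathcal{B}:=I^\perp/I,\bullet_{\mathcal{B}},\omega_{\mathcal{B}})$ by the one-dimensional algebra $\mathfrak{h}:=\mathcal{A}/I^\perp\simeq\mathbb{R}d$, by means of some $(D,\xi,b_0,\lambda)$; or a double extension of $(\mathcal{B}:=I^\perp/I,\bullet_{\mathcal{B}},\omega_{\mathcal{B}})$ by the two-dimensional commutative associative algebra $\mathfrak{h}:=\mathcal{A}/I^\perp\simeq\mathbb{R}d_1\oplus\mathbb{R}d_2$, by means of some $(D_i,\xi_i,a_0,b_{ij},l_i,t_{ij},s_{ij})$, $i,j\in\{1,2\}$.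
   Context: All vector spaces are finite-dimensional. $[u,v]_\bullet=u\bullet v-v\bullet u$, $[\mathcal{A},\mathcal{A}]=\mathrm{span}\{[u,v]_\bullet\}$. A pre-symplectic left-symmetric algebra is a triple $(\mathcal{A},\bullet,\omega)$ where $(u\bullet v)\bullet w-u\bullet(v\bullet w)=(v\bullet u)\bullet w-v\bullet(u\bullet w)$ and $\omega$ is a nondegenerate skew-symmetric bilinear form with $\omega(u\bullet v,w)=\omega(v,u\bullet w)$ for all $u,v,w$ (the zero space is allowed). For a subspace $V$, $V^\perp$ is the $\omega$-orthogonal; $V$ is degenerate if $V\cap V^\perp\ne\{0\}$, totally isotropic if $V\subset V^\perp$. For a two-sided ideal $I\subseteq[\mathcal{A},\mathcal{A}]\cap[\mathcal{A},\mathcal{A}]^\perp$, $I^\perp$ is a two-sided ideal; $\mathcal{B}=I^\perp/I$ carries the induced product and form (it is pre-symplectic left-symmetric), and $\mathfrak{h}=\mathcal{A}/I^\perp$ carries the induced product $\circ$, which is commutative associative. Double extension: let $(\mathcal{B},\bullet_{\mathcal{B}},\omega_{\mathcal{B}})$ be a pre-symplectic left-symmetric algebra and $(\mathfrak{h},\circ)$ a commutative associative algebra. The data are linear maps $F,G:\mathfrak{h}\to\mathrm{End}(\mathcal{B})$ with all $F(a)$ symmetric w.r.t. $\omega_{\mathcal{B}}$, bilinear maps $\theta,\Omega:\mathfrak{h}\times\mathfrak{h}\to\mathcal{B}$ with $\Omega$ skew-symmetric, and a bilinear $L:\mathfrak{h}\times\mathfrak{h}\to\mathfrak{h}^*$ with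 $L(a,b)(c)=-L(a,c)(b)$, such that for all $a,b,c,l\in\mathfrak{h}$, $u,v\in\mathcal{B}$ (writing $\bullet$ for $\bullet_{\mathcal{B}}$ and $T^*$ for the adjoint, $\omega_{\mathcal{B}}(Tx,y)=\omega_{\mathcal{B}}(x,T^*y)$): (A) $G(a)([u,v]_\bullet)=0$; $u\bullet G(a)v=v\bullet G(a)u$; $G(a)(u)\bullet v=F(a)(u)\bullet v$; $F(a)(u\bullet v)=u\bullet F(a)(v)$; $G(b)G(a)=G(b)F(a)$; $F(a)F(b)=F(b)F(a)$; $F(a)G(b)u=G(a\circ b)u+u\bullet\theta(a,b)$; $\theta(a,b)\bullet u=\theta(b,a)\bullet u$; $G(c)\theta(a,b)=G(c)\theta(b,a)$; $\theta(a,b\circ c)-\theta(b,a\circ c)=F(b)\theta(a,c)-F(a)\theta(b,c)$; (B) $G(a)^*G(b)=-G(b)^*G(a)$; $G(a)^*\Omega(b,c)=F(a)\Omega(b,c)$; $G(b)^*\theta(a,c)+\Omega(a\circ c,b)=-G(c)^*\theta(a,b)-\Omega(a\circ b,c)$; $L(a,b\circ c)(l)-L(b,a\circ c)(l)=-L(a,b\circ l)(c)+L(b,a\circ l)(c)$; $\omega_{\mathcal{B}}(\Omega(a,b),[u,v]_\bullet)=0$; $\omega_{\mathcal{B}}(\Omega(c,l),\theta(a,b)-\theta(b,a))=0$. The double extension of $\mathcal{B}$ by $\mathfrak{h}$ by means of $(F,G,\theta,L,\Omega)$ is $\mathfrak{h}\oplus\mathcal{B}\oplus\mathfrak{h}^*$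 with product $u\bullet v=u\bullet_{\mathcal{B}}v-\omega_{\mathcal{B}}(G(\cdot)u,v)$, $u\bullet a=G(a)u+\omega_{\mathcal{B}}(\Omega(a,\cdot),u)$, $a\bullet u=F(a)u-\omega_{\mathcal{B}}(\theta(a,\cdot),u)$, $a\bullet b=a\circ b+\theta(a,b)+L(a,b)$, $a\bullet f=(b\mapsto f(a\circ b))$, all other products zero ($a,b\in\mathfrak{h}$, $u,v\in\mathcal{B}$, $f\in\mathfrak{h}^*$; a dot marks the argument of an element of $\mathfrak{h}^*$), and form $\omega(u+a+f,v+b+g)=\omega_{\mathcal{B}}(u,v)+f(b)-g(a)$. "Is a double extension" means isomorphic to such an algebra by an algebra isomorphism preserving the forms. When $\mathfrak{h}=\mathbb{R}d$, "by means of $(D,\xi,b_0,\lambda)$" means that the data are $F(d)=\xi$, $G(d)=D$, $\theta(d,d)=b_0$, $L=\Omega=0$, $d\circ d=\lambda d$, with $\xi,D\in\mathrm{End}(\mathcal{B})$, $b_0\in\mathcal{B}$, $\lambda\in\mathbb{R}$. When $\mathfrak{h}=\mathbb{R}d_1\oplus\mathbb{R}d_2$, with dual basis $e_1,e_2$ of $\mathfrak{h}^*$, "by means of $(D_i,\xi_i,a_0,b_{ij},l_i,t_{ij},s_{ij})$" means that the data are $F(d_i)=\xi_i$, $G(d_i)=D_i$, $\theta(d_i,d_j)=b_{ij}$, $\Omega(d_1,d_2)=-\Omega(d_2,d_1)=a_0$, $\Omega(d_i,d_i)=0$, $L(d_i,d_1)=l_ie_2$, $L(d_i,d_2)=-l_ie_1$,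 $d_i\circ d_j=t_{ij}d_1+s_{ij}d_2$, with $\xi_i,D_i\in\mathrm{End}(\mathcal{B})$, $a_0,b_{ij}\in\mathcal{B}$, $l_i,t_{ij},s_{ij}\in\mathbb{R}$, $t_{ij}=t_{ji}$, $s_{ij}=s_{ji}$. *)

theory Defs
  imports "Jordan_Normal_Form.VS_Connect" "HOL-Algebra.QuotRing"
begin

text \<open>
  A real algebra, in general neither associative nor unital, is a record of type
  \<^typ>\<open>(real, 'a) module\<close>: the field \<^term>\<open>mult\<close> holds its product, the field \<^term>\<open>one\<close> is
  never used.  Maps between such structures are HOL functions that matter only on carriers.
\<close>

abbreviation reals_ring :: "real ring" where
  "reals_ring \<equiv> class_ring"

definition type_algebra :: "('a::real_vector \<Rightarrow> 'a \<Rightarrow> 'a) \<Rightarrow> (real, 'a) module" where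
  "type_algebra p = \<lparr>carrier = UNIV, mult = p, one = 0, zero = 0, add = (+), smult = (*\<^sub>R)\<rparr>"

abbreviation real_line :: "(real, real) module" where
  "real_line \<equiv> type_algebra (*)"

abbreviation linear_maps :: "(real, 'a) module \<Rightarrow> (real, 'b) module \<Rightarrow> ('a \<Rightarrow> 'b) set" where
  "linear_maps V W \<equiv> LinearCombinations.module_hom reals_ring V W"

definition fin_dim_space :: "(real, 'a) module \<Rightarrow> bool" where
  "fin_dim_space V \<longleftrightarrow> vectorspace reals_ring V \<and> vectorspace.fin_dim reals_ring V"

definition bilinear_map ::
  "(real, 'a) module \<Rightarrow> (real, 'b) module \<Rightarrow> (real, 'c) module \<Rightarrow> ('a \<Rightarrow> 'b \<Rightarrow> 'c) \<Rightarrow> bool" where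
  "bilinear_map U V W f \<longleftrightarrow>
    (\<forall>u\<in>carrier U. (\<lambda>v. f u v) \<in> linear_maps V W) \<and>
    (\<forall>v\<in>carrier V. (\<lambda>u. f u v) \<in> linear_maps U W)"

text \<open>The elements of the dual are made extensional so that equality in it is equality of HOL functions.\<close>

definition dual_space :: "(real, 'a) module \<Rightarrow> (real, 'a \<Rightarrow> real) module" where
  "dual_space V =
    \<lparr>carrier = linear_maps V real_line \<inter> extensional (carrier V),
     mult = (\<lambda>f g. \<lambda>x\<in>carrier V. 0), one = (\<lambda>x\<in>carrier V. 0),
     zero = (\<lambda>x\<in>carrier V. 0), add = (\<lambda>f g. \<lambda>x\<in>carrier V. f x + g x),
     smult = (\<lambda>c f. \<lambda>x\<in>carrier V. c * f x)\<rparr>"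

definition commutator :: "(real, 'a) module \<Rightarrow> 'a \<Rightarrow> 'a \<Rightarrow> 'a" where
  "commutator A u v = (u \<otimes>\<^bsub>A\<^esub> v) \<ominus>\<^bsub>A\<^esub> (v \<otimes>\<^bsub>A\<^esub> u)"

locale pre_symplectic_lsa =
  fixes A :: "(real, 'a) module" (structure) and \<omega> :: "'a \<Rightarrow> 'a \<Rightarrow> real"
  assumes space: "fin_dim_space A"
    and product_bilinear: "bilinear_map A A A (\<otimes>)"
    and left_symmetric: "\<lbrakk>u \<in> carrier A; v \<in> carrier A; w \<in> carrier A\<rbrakk> \<Longrightarrow>
      ((u \<otimes> v) \<otimes> w) \<ominus> (u \<otimes> (v \<otimes> w)) = ((v \<otimes> u) \<otimes> w) \<ominus> (v \<otimes> (u \<otimes> w))"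
    and form_bilinear: "bilinear_map A A real_line \<omega>"
    and form_skew: "\<lbrakk>u \<in> carrier A; v \<in> carrier A\<rbrakk> \<Longrightarrow> \<omega> u v = - \<omega> v u"
    and form_nondegenerate: "\<lbrakk>u \<in> carrier A; \<And>v. v \<in> carrier A \<Longrightarrow> \<omega> u v = 0\<rbrakk> \<Longrightarrow> u = \<zero>"
    and form_invariant: "\<lbrakk>u \<in> carrier A; v \<in> carrier A; w \<in> carrier A\<rbrakk> \<Longrightarrow>
      \<omega> (u \<otimes> v) w = \<omega> v (u \<otimes> w)"

locale comm_assoc_algebra =
  fixes H :: "(real, 'h) module" (structure)
  assumes space: "fin_dim_space H"
    and product_bilinear: "bilinear_map H H H (\<otimes>)"
    and product_comm: "\<lbrakk>a \<in> carrier H; b \<in> carrier H\<rbrakk> \<Longrightarrow> a \<otimes> b = b \<otimes> a"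
    and product_assoc: "\<lbrakk>a \<in> carrier H; b \<in> carrier H; c \<in> carrier H\<rbrakk> \<Longrightarrow>
      (a \<otimes> b) \<otimes> c = a \<otimes> (b \<otimes> c)"

text \<open>The algebra \<open>\<A>\<close> itself is carried by a type, with product \<open>p\<close> and form \<open>\<omega>\<close>.\<close>

definition commutator_ideal :: "('a::real_vector \<Rightarrow> 'a \<Rightarrow> 'a) \<Rightarrow> 'a set" where
  "commutator_ideal p = span {p u v - p v u | u v. True}"

definition perp :: "('a \<Rightarrow> 'a \<Rightarrow> real) \<Rightarrow> 'a set \<Rightarrow> 'a set" where
  "perp \<omega> V = {x. \<forall>v\<in>V. \<omega> x v = 0}"

definition degenerate :: "('a::zero \<Rightarrow> 'a \<Rightarrow> real) \<Rightarrow> 'a set \<Rightarrow> bool" where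
  "degenerate \<omega> V \<longleftrightarrow> V \<inter> perp \<omega> V \<noteq> {0}"

definition totally_isotropic :: "('a \<Rightarrow> 'a \<Rightarrow> real) \<Rightarrow> 'a set \<Rightarrow> bool" where
  "totally_isotropic \<omega> V \<longleftrightarrow> V \<subseteq> perp \<omega> V"

definition two_sided_ideal :: "('a::real_vector \<Rightarrow> 'a \<Rightarrow> 'a) \<Rightarrow> 'a set \<Rightarrow> bool" where
  "two_sided_ideal p I \<longleftrightarrow>
    Real_Vector_Spaces.subspace I \<and> (\<forall>x\<in>I. \<forall>y. p x y \<in> I \<and> p y x \<in> I)"

text \<open>The ring part is \<^term>\<open>A Quot J\<close>, except for the unused field \<^term>\<open>one\<close>.\<close>

definition quotient_algebra :: "(real, 'a) module \<Rightarrow> 'a set \<Rightarrow> (real, 'a set) module" where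
  "quotient_algebra A J =
    \<lparr>carrier = a_rcosets\<^bsub>A\<^esub> J, mult = rcoset_mult A J, one = J, zero = J, add = set_add A,
     smult = (\<lambda>c X. \<Union>x\<in>X. J +>\<^bsub>A\<^esub> (c \<odot>\<^bsub>A\<^esub> x))\<rparr>"

text \<open>The common value of the form on representatives.\<close>

definition quotient_form :: "('a \<Rightarrow> 'a \<Rightarrow> real) \<Rightarrow> 'a set \<Rightarrow> 'a set \<Rightarrow> real" where
  "quotient_form \<omega> X Y = the_elem {\<omega> x y | x y. x \<in> X \<and> y \<in> Y}"

definition perp_quotient ::
  "('a::real_vector \<Rightarrow> 'a \<Rightarrow> 'a) \<Rightarrow> ('a \<Rightarrow> 'a \<Rightarrow> real) \<Rightarrow> 'a set \<Rightarrow> (real, 'a set) module" where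
  "perp_quotient p \<omega> I = quotient_algebra ((type_algebra p)\<lparr>carrier := perp \<omega> I\<rparr>) I"

definition quotient_by_perp ::
  "('a::real_vector \<Rightarrow> 'a \<Rightarrow> 'a) \<Rightarrow> ('a \<Rightarrow> 'a \<Rightarrow> real) \<Rightarrow> 'a set \<Rightarrow> (real, 'a set) module" where
  "quotient_by_perp p \<omega> I = quotient_algebra (type_algebra p) (perp \<omega> I)"

definition adjoint_wrt :: "(real, 'b) module \<Rightarrow> ('b \<Rightarrow> 'b \<Rightarrow> real) \<Rightarrow> ('b \<Rightarrow> 'b) \<Rightarrow> 'b \<Rightarrow> 'b" where
  "adjoint_wrt B \<omega> T y = (THE z. z \<in> carrier B \<and> (\<forall>x\<in>carrier B. \<omega> (T x) y = \<omega> x z))"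

text \<open>
  Linear maps \<open>\<h> \<rightarrow> End(\<B>)\<close> are given as bilinear maps \<open>\<h> \<times> \<B> \<rightarrow> \<B>\<close>.
  The product of \<open>\<B>\<close> is \<open>\<otimes>\<close> (first structure), that of \<open>\<h>\<close> is \<open>\<otimes>\<^bsub>H\<^esub>\<close>.
\<close>

locale double_extension_data =
  B: pre_symplectic_lsa B \<omega> + H: comm_assoc_algebra H
  for B :: "(real, 'b) module" (structure) and \<omega> :: "'b \<Rightarrow> 'b \<Rightarrow> real"
    and H :: "(real, 'h) module" +
  fixes F G :: "'h \<Rightarrow> 'b \<Rightarrow> 'b" and \<theta> :: "'h \<Rightarrow> 'h \<Rightarrow> 'b"
    and L :: "'h \<Rightarrow> 'h \<Rightarrow> ('h \<Rightarrow> real)" and \<Omega> :: "'h \<Rightarrow> 'h \<Rightarrow> 'b"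
  assumes F_linear: "bilinear_map H B B F"
    and G_linear: "bilinear_map H B B G"
    and theta_bilinear: "bilinear_map H H B \<theta>"
    and Omega_bilinear: "bilinear_map H H B \<Omega>"
    and L_bilinear: "bilinear_map H H (dual_space H) L"
    and F_symmetric: "\<lbrakk>a \<in> carrier H; u \<in> carrier B; v \<in> carrier B\<rbrakk> \<Longrightarrow>
      \<omega> (F a u) v = \<omega> u (F a v)"
    and Omega_skew: "\<lbrakk>a \<in> carrier H; b \<in> carrier H\<rbrakk> \<Longrightarrow> \<Omega> a b = \<ominus> \<Omega> b a"
    and L_skew: "\<lbrakk>a \<in> carrier H; b \<in> carrier H; c \<in> carrier H\<rbrakk> \<Longrightarrow> L a b c = - L a c b"
    and A1: "\<lbrakk>a \<in> carrier H; u \<in> carrier B; v \<in> carrier B\<rbrakk> \<Longrightarrow>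
      G a (commutator B u v) = \<zero>"
    and A2: "\<lbrakk>a \<in> carrier H; u \<in> carrier B; v \<in> carrier B\<rbrakk> \<Longrightarrow>
      u \<otimes> G a v = v \<otimes> G a u"
    and A3: "\<lbrakk>a \<in> carrier H; u \<in> carrier B; v \<in> carrier B\<rbrakk> \<Longrightarrow>
      G a u \<otimes> v = F a u \<otimes> v"
    and A4: "\<lbrakk>a \<in> carrier H; u \<in> carrier B; v \<in> carrier B\<rbrakk> \<Longrightarrow>
      F a (u \<otimes> v) = u \<otimes> F a v"
    and A5: "\<lbrakk>a \<in> carrier H; b \<in> carrier H; u \<in> carrier B\<rbrakk> \<Longrightarrow>
      G b (G a u) = G b (F a u)"
    and A6: "\<lbrakk>a \<in> carrier H; b \<in> carrier H; u \<in> carrier B\<rbrakk> \<Longrightarrow>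
      F a (F b u) = F b (F a u)"
    and A7: "\<lbrakk>a \<in> carrier H; b \<in> carrier H; u \<in> carrier B\<rbrakk> \<Longrightarrow>
      F a (G b u) = G (a \<otimes>\<^bsub>H\<^esub> b) u \<oplus> (u \<otimes> \<theta> a b)"
    and A8: "\<lbrakk>a \<in> carrier H; b \<in> carrier H; u \<in> carrier B\<rbrakk> \<Longrightarrow>
      \<theta> a b \<otimes> u = \<theta> b a \<otimes> u"
    and A9: "\<lbrakk>a \<in> carrier H; b \<in> carrier H; c \<in> carrier H\<rbrakk> \<Longrightarrow>
      G c (\<theta> a b) = G c (\<theta> b a)"
    and A10: "\<lbrakk>a \<in> carrier H; b \<in> carrier H; c \<in> carrier H\<rbrakk> \<Longrightarrow>
      \<theta> a (b \<otimes>\<^bsub>H\<^esub> c) \<ominus> \<theta> b (a \<otimes>\<^bsub>H\<^esub> c) = F b (\<theta> a c) \<ominus> F a (\<theta> b c)"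
    and B1: "\<lbrakk>a \<in> carrier H; b \<in> carrier H; u \<in> carrier B\<rbrakk> \<Longrightarrow>
      adjoint_wrt B \<omega> (G a) (G b u) = \<ominus> adjoint_wrt B \<omega> (G b) (G a u)"
    and B2: "\<lbrakk>a \<in> carrier H; b \<in> carrier H; c \<in> carrier H\<rbrakk> \<Longrightarrow>
      adjoint_wrt B \<omega> (G a) (\<Omega> b c) = F a (\<Omega> b c)"
    and B3: "\<lbrakk>a \<in> carrier H; b \<in> carrier H; c \<in> carrier H\<rbrakk> \<Longrightarrow>
      adjoint_wrt B \<omega> (G b) (\<theta> a c) \<oplus> \<Omega> (a \<otimes>\<^bsub>H\<^esub> c) b
        = (\<ominus> adjoint_wrt B \<omega> (G c) (\<theta> a b)) \<ominus> \<Omega> (a \<otimes>\<^bsub>H\<^esub> b) c"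
    and B4: "\<lbrakk>a \<in> carrier H; b \<in> carrier H; c \<in> carrier H; l \<in> carrier H\<rbrakk> \<Longrightarrow>
      L a (b \<otimes>\<^bsub>H\<^esub> c) l - L b (a \<otimes>\<^bsub>H\<^esub> c) l = - L a (b \<otimes>\<^bsub>H\<^esub> l) c + L b (a \<otimes>\<^bsub>H\<^esub> l) c"
    and B5: "\<lbrakk>a \<in> carrier H; b \<in> carrier H; u \<in> carrier B; v \<in> carrier B\<rbrakk> \<Longrightarrow>
      \<omega> (\<Omega> a b) (commutator B u v) = 0"
    and B6: "\<lbrakk>a \<in> carrier H; b \<in> carrier H; c \<in> carrier H; l \<in> carrier H\<rbrakk> \<Longrightarrow>
      \<omega> (\<Omega> c l) (\<theta> a b \<ominus> \<theta> b a) = 0"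

text \<open>
  The triple \<open>(a, u, f)\<close> stands for \<open>a + u + f\<close> in \<open>\<h> \<oplus> \<B> \<oplus> \<h>\<^sup>*\<close>; the product is the biadditive
  expansion of the products of the three kinds of elements.
\<close>

definition dext_algebra ::
  "(real, 'b) module \<Rightarrow> ('b \<Rightarrow> 'b \<Rightarrow> real) \<Rightarrow> (real, 'h) module \<Rightarrow>
   ('h \<Rightarrow> 'b \<Rightarrow> 'b) \<Rightarrow> ('h \<Rightarrow> 'b \<Rightarrow> 'b) \<Rightarrow> ('h \<Rightarrow> 'h \<Rightarrow> 'b) \<Rightarrow>
   ('h \<Rightarrow> 'h \<Rightarrow> ('h \<Rightarrow> real)) \<Rightarrow> ('h \<Rightarrow> 'h \<Rightarrow> 'b) \<Rightarrow>
   (real, 'h \<times> 'b \<times> ('h \<Rightarrow> real)) module" where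
  "dext_algebra B \<omega> H F G \<theta> L \<Omega> =
    (direct_sum H (direct_sum B (dual_space H)))\<lparr>mult :=
      (\<lambda>(a, u, f) (b, v, g).
        (a \<otimes>\<^bsub>H\<^esub> b,
         (u \<otimes>\<^bsub>B\<^esub> v) \<oplus>\<^bsub>B\<^esub> G b u \<oplus>\<^bsub>B\<^esub> F a v \<oplus>\<^bsub>B\<^esub> \<theta> a b,
         \<lambda>c\<in>carrier H. - \<omega> (G c u) v + \<omega> (\<Omega> b c) u - \<omega> (\<theta> a c) v + L a b c + g (a \<otimes>\<^bsub>H\<^esub> c)))\<rparr>"

definition dext_form ::
  "('b \<Rightarrow> 'b \<Rightarrow> real) \<Rightarrow> 'h \<times> 'b \<times> ('h \<Rightarrow> real) \<Rightarrow> 'h \<times> 'b \<times> ('h \<Rightarrow> real) \<Rightarrow> real" where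
  "dext_form \<omega> = (\<lambda>(a, u, f) (b, v, g). \<omega> u v + f b - g a)"

definition isometric_isomorphic ::
  "(real, 'a) module \<Rightarrow> ('a \<Rightarrow> 'a \<Rightarrow> real) \<Rightarrow> (real, 'c) module \<Rightarrow> ('c \<Rightarrow> 'c \<Rightarrow> real) \<Rightarrow> bool" where
  "isometric_isomorphic A \<omega> A' \<omega>' \<longleftrightarrow>
    (\<exists>\<phi>. \<phi> \<in> linear_maps A A' \<and> bij_betw \<phi> (carrier A) (carrier A') \<and>
      (\<forall>x\<in>carrier A. \<forall>y\<in>carrier A. \<phi> (x \<otimes>\<^bsub>A\<^esub> y) = \<phi> x \<otimes>\<^bsub>A'\<^esub> \<phi> y) \<and>
      (\<forall>x\<in>carrier A. \<forall>y\<in>carrier A. \<omega>' (\<phi> x) (\<phi> y) = \<omega> x y))"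

definition is_double_extension ::
  "(real, 'a) module \<Rightarrow> ('a \<Rightarrow> 'a \<Rightarrow> real) \<Rightarrow> (real, 'b) module \<Rightarrow> ('b \<Rightarrow> 'b \<Rightarrow> real) \<Rightarrow>
   (real, 'h) module \<Rightarrow> ('h \<Rightarrow> 'b \<Rightarrow> 'b) \<Rightarrow> ('h \<Rightarrow> 'b \<Rightarrow> 'b) \<Rightarrow> ('h \<Rightarrow> 'h \<Rightarrow> 'b) \<Rightarrow>
   ('h \<Rightarrow> 'h \<Rightarrow> ('h \<Rightarrow> real)) \<Rightarrow> ('h \<Rightarrow> 'h \<Rightarrow> 'b) \<Rightarrow> bool" where
  "is_double_extension A \<omega>\<^sub>A B \<omega>\<^sub>B H F G \<theta> L \<Omega> \<longleftrightarrow>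
    double_extension_data B \<omega>\<^sub>B H F G \<theta> L \<Omega> \<and>
    isometric_isomorphic A \<omega>\<^sub>A (dext_algebra B \<omega>\<^sub>B H F G \<theta> L \<Omega>) (dext_form \<omega>\<^sub>B)"

definition double_extension_by_line ::
  "(real, 'a) module \<Rightarrow> ('a \<Rightarrow> 'a \<Rightarrow> real) \<Rightarrow> (real, 'b) module \<Rightarrow> ('b \<Rightarrow> 'b \<Rightarrow> real) \<Rightarrow>
   (real, 'h) module \<Rightarrow> 'h \<Rightarrow> ('b \<Rightarrow> 'b) \<Rightarrow> ('b \<Rightarrow> 'b) \<Rightarrow> 'b \<Rightarrow> real \<Rightarrow> bool" where
  "double_extension_by_line A \<omega>\<^sub>A B \<omega>\<^sub>B H d D \<xi> b\<^sub>0 lam \<longleftrightarrow>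
    vectorspace.basis reals_ring H {d} \<and>
    D \<in> linear_maps B B \<and> \<xi> \<in> linear_maps B B \<and> b\<^sub>0 \<in> carrier B \<and>
    d \<otimes>\<^bsub>H\<^esub> d = lam \<odot>\<^bsub>H\<^esub> d \<and>
    (\<exists>F G \<theta> L \<Omega>. is_double_extension A \<omega>\<^sub>A B \<omega>\<^sub>B H F G \<theta> L \<Omega> \<and>
      (\<forall>u\<in>carrier B. F d u = \<xi> u \<and> G d u = D u) \<and>
      \<theta> d d = b\<^sub>0 \<and>
      (\<forall>a\<in>carrier H. \<forall>b\<in>carrier H. L a b = \<zero>\<^bsub>dual_space H\<^esub> \<and> \<Omega> a b = \<zero>\<^bsub>B\<^esub>))"

text \<open>
  \<open>\<h> = \<real>d\<^sub>1 \<oplus> \<real>d\<^sub>2\<close>, by means of \<open>(D\<^sub>i, \<xi>\<^sub>i, a\<^sub>0, b\<^sub>i\<^sub>j, l\<^sub>i, t\<^sub>i\<^sub>j, s\<^sub>i\<^sub>j)\<close>: families are functions on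
  \<^typ>\<open>nat\<close> used only at the indices 1 and 2, and \<open>e 1, e 2\<close> is the dual basis.
\<close>

definition double_extension_by_plane ::
  "(real, 'a) module \<Rightarrow> ('a \<Rightarrow> 'a \<Rightarrow> real) \<Rightarrow> (real, 'b) module \<Rightarrow> ('b \<Rightarrow> 'b \<Rightarrow> real) \<Rightarrow>
   (real, 'h) module \<Rightarrow> (nat \<Rightarrow> 'h) \<Rightarrow> (nat \<Rightarrow> 'b \<Rightarrow> 'b) \<Rightarrow> (nat \<Rightarrow> 'b \<Rightarrow> 'b) \<Rightarrow> 'b \<Rightarrow>
   (nat \<Rightarrow> nat \<Rightarrow> 'b) \<Rightarrow> (nat \<Rightarrow> real) \<Rightarrow> (nat \<Rightarrow> nat \<Rightarrow> real) \<Rightarrow> (nat \<Rightarrow> nat \<Rightarrow> real) \<Rightarrow> bool" where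
  "double_extension_by_plane A \<omega>\<^sub>A B \<omega>\<^sub>B H d D \<xi> a\<^sub>0 b l t s \<longleftrightarrow>
    d 1 \<noteq> d 2 \<and> vectorspace.basis reals_ring H {d 1, d 2} \<and>
    a\<^sub>0 \<in> carrier B \<and>
    (\<forall>i\<in>{1, 2}. D i \<in> linear_maps B B \<and> \<xi> i \<in> linear_maps B B) \<and>
    (\<forall>i\<in>{1, 2}. \<forall>j\<in>{1, 2}.
      b i j \<in> carrier B \<and> t i j = t j i \<and> s i j = s j i \<and>
      d i \<otimes>\<^bsub>H\<^esub> d j = (t i j \<odot>\<^bsub>H\<^esub> d 1) \<oplus>\<^bsub>H\<^esub> (s i j \<odot>\<^bsub>H\<^esub> d 2)) \<and>
    (\<exists>F G \<theta> L \<Omega> e. is_double_extension A \<omega>\<^sub>A B \<omega>\<^sub>B H F G \<theta> L \<Omega> \<and>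
      (\<forall>j\<in>{1, 2}. e j \<in> carrier (dual_space H) \<and>
        (\<forall>k\<in>{1, 2}. e j (d k) = (if j = k then 1 else 0))) \<and>
      (\<forall>i\<in>{1, 2}. \<forall>u\<in>carrier B. F (d i) u = \<xi> i u \<and> G (d i) u = D i u) \<and>
      (\<forall>i\<in>{1, 2}. \<forall>j\<in>{1, 2}. \<theta> (d i) (d j) = b i j) \<and>
      \<Omega> (d 1) (d 2) = a\<^sub>0 \<and> \<Omega> (d 2) (d 1) = \<ominus>\<^bsub>B\<^esub> a\<^sub>0 \<and>
      (\<forall>i\<in>{1, 2}. \<Omega> (d i) (d i) = \<zero>\<^bsub>B\<^esub>) \<and>
      (\<forall>i\<in>{1, 2}. L (d i) (d 1) = l i \<odot>\<^bsub>dual_space H\<^esub> e 2 \<and>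
        L (d i) (d 2) = (- l i) \<odot>\<^bsub>dual_space H\<^esub> e (1::nat)))"

end

theory Submission
  imports Defs "HOL-Computational_Algebra.Fundamental_Theorem_Algebra"
begin

text \<open>
  Write \<open>L u\<close> for left multiplication by \<open>u\<close>.  Invariance of the form makes every \<open>L u\<close> symmetric.
  Left symmetry identifies the left multiplication by a commutator of \<open>u\<close> and \<open>v\<close> with the operator
  commutator of \<open>L u\<close> and \<open>L v\<close>; the first is symmetric, the second antisymmetric, so both vanish.
  Hence all \<open>L u\<close> commute and \<open>L\<close> is zero on the commutator ideal (\<open>left_mult_commute\<close>,
  \<open>left_mult_swap\<close>).  Degeneracy says that the intersection \<open>central_part\<close> of the commutator ideal
  with its orthogonal is nonzero; it is invariant under all \<open>L u\<close>, and its elements multiply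
  everything to zero from the left.  Commuting real operators on a nonzero space leave invariant a line,
  or a plane on which they act as complex numbers
  (\<open>commuting_real_operators_small_invariant_subspace\<close>).  This line or plane is the ideal \<open>I\<close>.

  Choose an isotropic complement \<open>\<h>\<close> of the orthogonal of \<open>I\<close>, put in duality with \<open>I\<close> by the form,
  and let \<open>\<B>\<close> be the orthogonal of \<open>\<h> + I\<close>.  Then the algebra is the direct sum of \<open>\<h>\<close>, \<open>\<B>\<close> and \<open>I\<close>,
  the last one being the dual of \<open>\<h>\<close>, and the components of the products are the data of a double
  extension of \<open>\<B>\<close> by \<open>\<h>\<close>.  The conditions on the data are components of the three laws that \<open>L\<close> is
  symmetric, that it commutes, and that it kills commutators.

  One condition, the cocycle identity B4, requires care: the laws yield it only up to a term that
  depends on the complement.  When \<open>I\<close> is a line both sides vanish.  When \<open>I\<close> is a plane, \<open>\<h>\<close> is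
  the field of complex numbers acting on it, and the complement can be chosen to make the identity hold:
  take any lift \<open>e\<close> of \<open>1\<close> and any lift \<open>d\<^sub>0\<close> of \<open>\<i>\<close>, and let \<open>\<h>\<close> be spanned by \<open>e\<close> and \<open>p d\<^sub>0 e\<close>
  (\<open>plane_frame_exists\<close>).

  The quotients by \<open>I\<close> and by its orthogonal consist of cosets.  Each coset is computed with through its
  representative in \<open>\<B>\<close> or \<open>\<h>\<close>; this turns every condition on the data into an identity in the
  algebra itself (\<open>frame_model\<close>, \<open>projected_quotient\<close>).
\<close>

section \<open>Finite-dimensional real vector spaces\<close>

definition finite_dimensional :: "'a::real_vector itself \<Rightarrow> bool" where
  "finite_dimensional _ \<longleftrightarrow> (\<exists>S::'a set. finite S \<and> span S = UNIV)"

lemma finite_dimensional_basis: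
  assumes "finite_dimensional TYPE('a::real_vector)"
  obtains B :: "'a::real_vector set" where "finite_dimensional_vector_space scaleR B"
proof -
  obtain S :: "'a set" where S: "finite S" "span S = UNIV"
    using assms unfolding finite_dimensional_def by blast
  obtain B where B: "B \<subseteq> S" "independent B" "S \<subseteq> span B"
    using real_vector.maximal_independent_subset[of S] by blast
  have "span B = UNIV"
    using B(3) S(2) span_minimal[OF B(3) subspace_span] by auto
  moreover have "finite B"
    using B(1) S(1) finite_subset by blast
  ultimately have "finite_dimensional_vector_space scaleR B"
    using B(2) by unfold_locales (auto simp: dependent_raw_def span_raw_def)
  then show ?thesis using that by blast
qed

lemma dim_less_if_subspace_psubset:
  fixes V W :: "'a::real_vector set"
  assumes "finite_dimensional TYPE('a)" "Real_Vector_Spaces.subspace V"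
    "Real_Vector_Spaces.subspace W" "V \<subset> W"
  shows "dim V < dim W"
proof -
  obtain B :: "'a set" where "finite_dimensional_vector_space scaleR B"
    using finite_dimensional_basis[OF assms(1)] .
  then interpret F: finite_dimensional_vector_space scaleR B .
  have "span V \<subset> span W"
    using assms(2-4) by (metis real_vector.span_eq_iff)
  then show ?thesis
    by (rule F.dim_psubset[folded span_raw_def dim_raw_def])
qed

lemma inj_endomorphism_is_surj:
  fixes f :: "'a::real_vector \<Rightarrow> 'a"
  assumes "finite_dimensional TYPE('a)" "linear f" "inj f"
  shows "surj f"
proof -
  obtain B :: "'a set" where "finite_dimensional_vector_space scaleR B"
    using finite_dimensional_basis[OF assms(1)] .
  then interpret F: finite_dimensional_vector_space scaleR B .
  have "Vector_Spaces.linear scaleR scaleR f"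
    using assms(2) by (simp add: linear_def)
  then show ?thesis
    using F.linear_inj_imp_surj assms(3) by blast
qed

text \<open>
  The endomorphism \<open>x \<mapsto> \<Sum>b\<in>B. \<omega> x b *\<^sub>R b\<close> records the functional \<open>\<omega> x\<close> on a basis \<open>B\<close>.
  Nondegeneracy makes it injective, hence surjective, and so every functional is reached.
\<close>
lemma functional_represented_by_form:
  fixes \<omega> :: "'a::real_vector \<Rightarrow> 'a \<Rightarrow> real"
  assumes fd: "finite_dimensional TYPE('a)"
    and l1: "\<And>y. linear (\<lambda>x. \<omega> x y)" and l2: "\<And>x. linear (\<omega> x)"
    and nd: "\<And>x. (\<And>y. \<omega> x y = 0) \<Longrightarrow> x = 0"
    and g: "linear g"
  obtains x where "\<And>y. \<omega> x y = g y"
proof -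
  obtain B :: "'a set" where "finite_dimensional_vector_space scaleR B"
    using finite_dimensional_basis[OF fd] .
  then interpret F: finite_dimensional_vector_space scaleR B .
  have B: "finite B" "independent B" "span B = UNIV"
    using F.finite_Basis F.independent_Basis F.span_Basis
    by (simp_all add: dependent_raw_def span_raw_def)
  define f where "f x = (\<Sum>b\<in>B. \<omega> x b *\<^sub>R b)" for x
  have coeff: "u b = v b" if "(\<Sum>b\<in>B. u b *\<^sub>R b) = (\<Sum>b\<in>B. v b *\<^sub>R b)" "b \<in> B"
    for u v :: "'a \<Rightarrow> real" and b
  proof -
    have "(\<Sum>b\<in>B. (u b - v b) *\<^sub>R b) = 0"
      using that(1) by (simp add: scaleR_diff_left sum_subtractf)
    then have "u b - v b = 0"
      using independentD[OF B(2) B(1) order.refl _ that(2), of "\<lambda>b. u b - v b"] by simp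
    then show ?thesis by simp
  qed
  have ext: "h = k" if "linear h" "linear k" "\<And>b. b \<in> B \<Longrightarrow> h b = k b"
    for h k :: "'a \<Rightarrow> real"
    using that B(3) linear_eq_on[of h k _ B] by (intro ext) blast
  have "linear f"
    unfolding f_def
    by (intro linearI) (simp_all add: linear_add[OF l1] linear_scale[OF l1]
        scaleR_add_left sum.distrib scaleR_sum_right)
  moreover have "inj f"
  proof (rule injI)
    fix x y assume "f x = f y"
    then have "\<omega> x b = \<omega> y b" if "b \<in> B" for b
      using coeff[of "\<omega> x" "\<omega> y" b] that unfolding f_def by blast
    then have "\<omega> x = \<omega> y" using ext[OF l2 l2] by blast
    then have "\<omega> (x - y) z = 0" for z
      using linear_diff[OF l1[of z], of x y] by simp
    then show "x = y" using nd[of "x - y"] by simp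
  qed
  ultimately have "surj f" by (rule inj_endomorphism_is_surj[OF fd])
  then obtain x where x: "f x = (\<Sum>b\<in>B. g b *\<^sub>R b)" by (metis surjD)
  then have "\<omega> x b = g b" if "b \<in> B" for b
    using coeff[of "\<omega> x" g b] that unfolding f_def by blast
  then have "\<omega> x = g" using ext[OF l2 g] by blast
  then show ?thesis using that by metis
qed

section \<open>Commuting families of operators over the reals\<close>

text \<open>The vector \<open>q(T) x\<close>, by Horner's scheme: this form makes induction over \<^term>\<open>pCons\<close> direct.\<close>
definition poly_act :: "('a::real_vector \<Rightarrow> 'a) \<Rightarrow> real poly \<Rightarrow> 'a \<Rightarrow> 'a" where
  "poly_act T q = fold_coeffs (\<lambda>a f x. a *\<^sub>R x + T (f x)) q (\<lambda>x. 0)"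

context
  fixes T :: "'a::real_vector \<Rightarrow> 'a"
  assumes T: "linear T"
begin

lemma poly_act_0 [simp]: "poly_act T 0 x = 0"
  by (simp add: poly_act_def)

lemma poly_act_pCons [simp]: "poly_act T (pCons a q) x = a *\<^sub>R x + T (poly_act T q x)"
proof (cases "a = 0 \<and> q = 0")
  case True
  then show ?thesis using linear_0[OF T] by simp
next
  case False
  then show ?thesis
    by (cases "a = 0") (auto simp: poly_act_def)
qed

lemma linear_poly_act: "linear (poly_act T q)"
  by (induction q)
    (auto intro!: linearI simp: linear_add linear_scale algebra_simps linear_add[OF T] linear_scale[OF T])

lemma poly_act_add: "poly_act T (q + r) x = poly_act T q x + poly_act T r x"
  by (induction q r rule: poly_induct2) (simp_all add: linear_add[OF T] algebra_simps)

lemma poly_act_smult: "poly_act T (smult c q) x = c *\<^sub>R poly_act T q x"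
  by (induction q) (simp_all add: linear_scale[OF T] algebra_simps)

lemma poly_act_diff: "poly_act T (q - r) x = poly_act T q x - poly_act T r x"
  using poly_act_add[of "q - r" r x] by simp

lemma poly_act_mult: "poly_act T (q * r) x = poly_act T q (poly_act T r x)"
  by (induction q) (simp_all add: poly_act_add poly_act_smult)

lemma poly_act_monom: "poly_act T (monom c n) x = c *\<^sub>R (T ^^ n) x"
  by (induction n) (simp_all add: monom_0 monom_Suc linear_0[OF T] linear_scale[OF T])

lemma poly_act_sum: "poly_act T (\<Sum>i\<in>A. f i) x = (\<Sum>i\<in>A. poly_act T (f i) x)"
  by (induction A rule: infinite_finite_induct) (simp_all add: poly_act_add)

lemma poly_act_in_subspace:
  assumes "Real_Vector_Spaces.subspace W" "\<And>x. x \<in> W \<Longrightarrow> T x \<in> W" "x \<in> W"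
  shows "poly_act T q x \<in> W"
  by (induction q) (use assms in \<open>auto simp: subspace_0 subspace_add subspace_scale\<close>)

text \<open>Otherwise the vectors \<open>x, T x, T\<^sup>2 x, \<dots>\<close> would be linearly independent.\<close>
lemma annihilating_poly_exists:
  assumes "finite_dimensional TYPE('a)"
  shows "\<exists>q. q \<noteq> 0 \<and> poly_act T q x = 0"
proof (rule ccontr)
  assume "\<nexists>q. q \<noteq> 0 \<and> poly_act T q x = 0"
  then have no: "q = 0" if "poly_act T q x = 0" for q using that by blast
  have inj: "inj (\<lambda>i. (T ^^ i) x)"
  proof (rule injI)
    fix i j assume "(T ^^ i) x = (T ^^ j) x"
    then have "poly_act T (monom 1 i - monom 1 j) x = 0"
      by (simp add: poly_act_diff poly_act_monom)
    from no[OF this] show "i = j" by (metis eq_iff_diff_eq_0 degree_monom_eq one_neq_zero)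
  qed
  have indep: "independent ((\<lambda>i. (T ^^ i) x) ` {..<k})" for k
  proof
    assume "dependent ((\<lambda>i. (T ^^ i) x) ` {..<k})"
    then obtain u where u: "\<exists>v\<in>(\<lambda>i. (T ^^ i) x) ` {..<k}. u v \<noteq> 0"
      "(\<Sum>v\<in>(\<lambda>i. (T ^^ i) x) ` {..<k}. u v *\<^sub>R v) = (0::'a)"
      using real_vector.dependent_finite[of "(\<lambda>i. (T ^^ i) x) ` {..<k}"] by blast
    define q where "q = (\<Sum>i<k. monom (u ((T ^^ i) x)) i)"
    have "poly_act T q x = (\<Sum>i<k. u ((T ^^ i) x) *\<^sub>R (T ^^ i) x)"
      unfolding q_def by (simp add: poly_act_sum poly_act_monom)
    also have "\<dots> = 0"
      using u(2) by (subst (asm) sum.reindex[OF inj_on_subset[OF inj]]) auto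
    finally have "q = 0" by (rule no)
    then have "u ((T ^^ i) x) = 0" if "i < k" for i
    proof -
      have "coeff q i = (\<Sum>j<k. if j = i then u ((T ^^ j) x) else 0)"
        unfolding q_def by (simp add: coeff_sum)
      also have "\<dots> = u ((T ^^ i) x)" using that by simp
      finally show ?thesis using \<open>q = 0\<close> by simp
    qed
    with u(1) show False by auto
  qed
  obtain S :: "'a set" where S: "finite S" "span S = UNIV"
    using assms unfolding finite_dimensional_def by blast
  have "card ((\<lambda>i. (T ^^ i) x) ` {..<Suc (card S)}) \<le> card S"
    using independent_span_bound[OF S(1) indep, of "Suc (card S)"] S(2) by blast
  then show False
    by (subst (asm) card_image[OF inj_on_subset[OF inj]]) auto
qed

end

text \<open>
  Multiplication by a complex number \<open>z\<close> is itself a real operator, and acting with it on \<open>1\<close>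
  evaluates real polynomials at \<open>z\<close>.  Thus the multiplicativity of \<^const>\<open>poly_act\<close> also serves to
  compare a real polynomial with its quadratic factors at a complex root.
\<close>
lemma poly_act_complex: "poly_act ((*) z) q (1::complex) = poly (map_poly complex_of_real q) z"
proof -
  have "linear ((*) z)" by (intro linearI) (simp_all add: algebra_simps)
  then show ?thesis
    by (induction q) (simp_all add: map_poly_pCons scaleR_conv_of_real)
qed

text \<open>
  A complex root \<open>z\<close> gives the factor \<open>X - z\<close> if \<open>z\<close> is real.  Otherwise the remainder modulo
  \<open>X\<^sup>2 - 2 Re z X + \<bar>z\<bar>\<^sup>2\<close> is a linear real polynomial with a nonreal root, that is, zero.
\<close>
lemma real_poly_has_quadratic_factor:
  fixes q :: "real poly"
  assumes "degree q > 0"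
  obtains \<alpha> where "[:- \<alpha>, 1:] dvd q" | \<alpha> \<beta> where "[:\<alpha>\<^sup>2 + \<beta>\<^sup>2, - 2 * \<alpha>, 1:] dvd q"
proof -
  have "degree (map_poly complex_of_real q) = degree q" by (simp add: degree_map_poly)
  then have "\<not> constant (poly (map_poly complex_of_real q))"
    using assms by (simp add: constant_degree)
  then obtain z where "poly (map_poly complex_of_real q) z = 0"
    using fundamental_theorem_of_algebra by blast
  then have z: "poly_act ((*) z) q 1 = 0" by (simp add: poly_act_complex)
  have lin: "linear ((*) z)" by (intro linearI) (simp_all add: algebra_simps)
  show ?thesis
  proof (cases "Im z = 0")
    case True
    then have zr: "z = complex_of_real (Re z)" by (simp add: complex_eq_iff)
    have "poly_act ((*) z) q 1 = complex_of_real (poly q (Re z))"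
      using lin by (subst (1) zr, induction q) (auto simp: scaleR_conv_of_real zr[symmetric])
    with z have "poly q (Re z) = 0" by simp
    then show ?thesis using that(1) by (simp add: poly_eq_0_iff_dvd)
  next
    case False
    define d where "d = [:(Re z)\<^sup>2 + (Im z)\<^sup>2, - 2 * Re z, 1:]"
    have dz: "poly_act ((*) z) d 1 = 0"
      using lin by (simp add: d_def complex_eq_iff power2_eq_square algebra_simps)
    have "degree (q mod d) < 2"
      using degree_mod_less[of d q] by (auto simp: d_def)
    then obtain a b where r: "q mod d = [:a, b:]"
      by (metis One_nat_def degree_eq_zeroE less_2_cases pCons_0_0 degree1_coeffs)
    have "q = (q div d) * d + q mod d" by simp
    then have "poly_act ((*) z) [:a, b:] 1 = 0"
      using z dz by (metis add_0 poly_act_add[OF lin] poly_act_mult[OF lin] linear_0 linear_poly_act[OF lin] r)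
    then have "a = 0 \<and> b = 0"
      using lin False by (auto simp: complex_eq_iff)
    then have "d dvd q" using r by (simp add: dvd_eq_mod_eq_0)
    then show ?thesis using that(2) unfolding d_def by blast
  qed
qed

text \<open>
  Among the polynomials that annihilate some nonzero vector of \<open>W\<close> take one of least degree.  By
  minimality it is irreducible, hence of degree at most two.
\<close>
lemma real_operator_quadratic_vector:
  fixes T :: "'a::real_vector \<Rightarrow> 'a"
  assumes fd: "finite_dimensional TYPE('a)" and T: "linear T"
    and W: "Real_Vector_Spaces.subspace W" "W \<noteq> {0}" "\<And>x. x \<in> W \<Longrightarrow> T x \<in> W"
  obtains x \<alpha> \<beta> where "x \<in> W" "x \<noteq> 0"
    "\<beta> = 0 \<Longrightarrow> T x = \<alpha> *\<^sub>R x" "T (T x) = (2 * \<alpha>) *\<^sub>R T x - (\<alpha>\<^sup>2 + \<beta>\<^sup>2) *\<^sub>R x"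
proof -
  define P where "P q \<longleftrightarrow> q \<noteq> 0 \<and> (\<exists>x\<in>W. x \<noteq> 0 \<and> poly_act T q x = 0)" for q
  obtain x0 where x0: "x0 \<in> W" "x0 \<noteq> 0"
    using W(1,2) subspace_0 by blast
  obtain q0 where "P q0"
    using annihilating_poly_exists[OF T fd, of x0] x0 unfolding P_def by blast
  define q where "q = arg_min degree P"
  have q: "P q" and qmin: "\<And>r. P r \<Longrightarrow> degree q \<le> degree r"
    using arg_min_natI[of P q0 degree] arg_min_nat_le[of P _ degree] \<open>P q0\<close>
    unfolding q_def by blast+
  obtain x where x: "q \<noteq> 0" "x \<in> W" "x \<noteq> 0" "poly_act T q x = 0"
    using q unfolding P_def by blast
  have "degree q > 0"
  proof (rule ccontr)
    assume "\<not> degree q > 0"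
    then obtain c where "q = [:c:]" using degree_eq_zeroE by blast
    then show False using x T by (simp add: linear_0[OF T])
  qed
  \<comment> \<open>By minimality the cofactor of a nonconstant factor \<open>d\<close> moves \<open>x\<close> to a nonzero vector killed by \<open>d\<close>.\<close>
  have key: "\<exists>y\<in>W. y \<noteq> 0 \<and> poly_act T d y = 0" if d: "d dvd q" "degree d > 0" for d
  proof -
    obtain e where e: "q = d * e" using d(1) by (auto simp: dvd_def)
    have ne: "d \<noteq> 0" "e \<noteq> 0" using x(1) e by auto
    have "degree e < degree q" using e ne d(2) by (simp add: degree_mult_eq)
    then have "\<not> P e" using qmin leD by blast
    then have "poly_act T e x \<noteq> 0" using ne x unfolding P_def by blast
    moreover have "poly_act T e x \<in> W" using poly_act_in_subspace[OF T W(1,3) x(2)] by blast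
    moreover have "poly_act T d (poly_act T e x) = 0"
      using x(4) e by (simp add: poly_act_mult[OF T])
    ultimately show ?thesis by blast
  qed
  from \<open>degree q > 0\<close> show ?thesis
  proof (cases rule: real_poly_has_quadratic_factor)
    case (1 \<alpha>)
    then obtain y where y: "y \<in> W" "y \<noteq> 0" "poly_act T [:- \<alpha>, 1:] y = 0" using key by fastforce
    then have Ty: "T y = \<alpha> *\<^sub>R y" using T by (simp add: linear_0[OF T])
    then have "T (T y) = (2 * \<alpha>) *\<^sub>R T y - (\<alpha>\<^sup>2 + 0\<^sup>2) *\<^sub>R y"
      by (simp add: linear_scale[OF T] power2_eq_square algebra_simps flip: scaleR_add_left)
    then show ?thesis using that[of y 0 \<alpha>] y Ty by blast
  next
    case (2 \<alpha> \<beta>)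
    then obtain y where y: "y \<in> W" "y \<noteq> 0" "poly_act T [:\<alpha>\<^sup>2 + \<beta>\<^sup>2, - 2 * \<alpha>, 1:] y = 0"
      using key by fastforce
    then have e: "T (T y) = (2 * \<alpha>) *\<^sub>R T y - (\<alpha>\<^sup>2 + \<beta>\<^sup>2) *\<^sub>R y"
      using T by (simp add: linear_0[OF T] linear_add[OF T] linear_diff[OF T] linear_scale[OF T] algebra_simps)
    show ?thesis
    proof (cases "\<beta> = 0 \<and> T y \<noteq> \<alpha> *\<^sub>R y")
      case False
      then show ?thesis using that[of y \<beta> \<alpha>] y e by blast
    next
      case True
      define w where "w = T y - \<alpha> *\<^sub>R y"
      have w: "w \<in> W" "w \<noteq> 0" using True W y by (auto simp: w_def subspace_diff subspace_scale)
      have "T w = \<alpha> *\<^sub>R w"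
        using e True by (simp add: w_def linear_diff[OF T] linear_scale[OF T] algebra_simps power2_eq_square
            flip: scaleR_add_left)
      moreover from this have "T (T w) = (2 * \<alpha>) *\<^sub>R T w - (\<alpha>\<^sup>2 + 0\<^sup>2) *\<^sub>R w"
        by (simp add: linear_scale[OF T] power2_eq_square algebra_simps flip: scaleR_add_left)
      ultimately show ?thesis using that[of w 0 \<alpha>] w by blast
    qed
  qed
qed

text \<open>
  On a minimal invariant subspace \<open>W\<close> every operator of the family is annihilated by a polynomial
  \<open>(X - \<alpha>)\<^sup>2 + \<beta>\<^sup>2\<close>, because kernels of commuting operators are invariant (Schur's lemma).  If some
  \<open>L u\<close> is not scalar, then \<open>J = (L u - \<alpha>) / \<beta>\<close> is a complex structure; any other one, \<open>J'\<close>, in the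
  family satisfies \<open>(J - J') (J + J') = 0\<close>, hence \<open>J' = J\<close> or \<open>J' = - J\<close>, so that all operators are
  combinations of \<open>1\<close> and \<open>J\<close>.
\<close>
lemma commuting_real_operators_small_invariant_subspace:
  fixes L :: "'i \<Rightarrow> 'a::real_vector \<Rightarrow> 'a"
  assumes fd: "finite_dimensional TYPE('a)" and lin: "\<And>u. linear (L u)"
    and W0: "Real_Vector_Spaces.subspace W\<^sub>0" "W\<^sub>0 \<noteq> {0}" "\<And>u x. x \<in> W\<^sub>0 \<Longrightarrow> L u x \<in> W\<^sub>0"
    and comm: "\<And>u v x. x \<in> W\<^sub>0 \<Longrightarrow> L u (L v x) = L v (L u x)"
  obtains x where "x \<in> W\<^sub>0" "x \<noteq> 0" "\<And>u. \<exists>c. L u x = c *\<^sub>R x"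
  | x u \<alpha> \<beta> where "x \<in> W\<^sub>0" "x \<noteq> 0" "\<beta> \<noteq> 0"
    "L u (L u x) = (2 * \<alpha>) *\<^sub>R L u x - (\<alpha>\<^sup>2 + \<beta>\<^sup>2) *\<^sub>R x"
    "\<And>v. \<exists>a b. L v x = a *\<^sub>R x + b *\<^sub>R L u x"
proof -
  define invar where "invar W \<longleftrightarrow> Real_Vector_Spaces.subspace W \<and> W \<noteq> {0} \<and> W \<subseteq> W\<^sub>0 \<and> (\<forall>u. \<forall>x\<in>W. L u x \<in> W)" for W
  have "invar W\<^sub>0" using W0 by (auto simp: invar_def)
  define W where "W = arg_min dim invar"
  have invarW: "invar W" and Wmin: "\<And>V. invar V \<Longrightarrow> dim W \<le> dim V"
    using arg_min_natI[of invar W\<^sub>0 dim] arg_min_nat_le[of invar _ dim] \<open>invar W\<^sub>0\<close>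
    unfolding W_def by blast+
  have W: "Real_Vector_Spaces.subspace W" "W \<noteq> {0}" "\<And>x. x \<in> W \<Longrightarrow> x \<in> W\<^sub>0" "\<And>u x. x \<in> W \<Longrightarrow> L u x \<in> W"
    using invarW unfolding invar_def by blast+
  have commW: "L u (L v x) = L v (L u x)" if "x \<in> W" for u v x
    using comm W(3) that by blast
  note L_simps = linear_0[OF lin] linear_add[OF lin] linear_diff[OF lin] linear_scale[OF lin]
  have schur: "S y = 0"
    if S: "linear S" and x: "x \<in> W" "x \<noteq> 0" "S x = 0" and y: "y \<in> W"
      and Sc: "\<And>u z. z \<in> W \<Longrightarrow> S (L u z) = L u (S z)" for S :: "'a \<Rightarrow> 'a" and x y
  proof -
    let ?K = "{z \<in> W. S z = 0}"
    have "Real_Vector_Spaces.subspace ?K"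
      using W(1) S by (auto simp: Real_Vector_Spaces.subspace_def linear_0 linear_add linear_scale)
    moreover have "invar ?K"
      unfolding invar_def using calculation x W Sc by (auto simp: L_simps)
    ultimately have "\<not> ?K \<subset> W"
      using dim_less_if_subspace_psubset[OF fd _ W(1)] Wmin leD by blast
    then show ?thesis using y by blast
  qed
  obtain x where x: "x \<in> W" "x \<noteq> 0" using W(1,2) subspace_0 by blast
  have quad: "(\<exists>c. \<forall>y\<in>W. L u y = c *\<^sub>R y) \<or> (\<exists>\<alpha> \<beta>. \<beta> \<noteq> 0 \<and>
    (\<forall>y\<in>W. L u (L u y) = (2 * \<alpha>) *\<^sub>R L u y - (\<alpha>\<^sup>2 + \<beta>\<^sup>2) *\<^sub>R y))" for u
  proof -
    obtain z \<alpha> \<beta> where z: "z \<in> W" "z \<noteq> 0" "\<beta> = 0 \<Longrightarrow> L u z = \<alpha> *\<^sub>R z"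
      "L u (L u z) = (2 * \<alpha>) *\<^sub>R L u z - (\<alpha>\<^sup>2 + \<beta>\<^sup>2) *\<^sub>R z"
      using real_operator_quadratic_vector[OF fd lin W(1,2,4)] by metis
    show ?thesis
    proof (cases "\<beta> = 0")
      case True
      have "L u y - \<alpha> *\<^sub>R y = 0" if "y \<in> W" for y
        by (rule schur[of "\<lambda>y. L u y - \<alpha> *\<^sub>R y" z])
          (use z True that commW in \<open>auto intro!: linearI simp: L_simps algebra_simps\<close>)
      then have "\<forall>y\<in>W. L u y = \<alpha> *\<^sub>R y" by simp
      then show ?thesis by blast
    next
      case False
      have "L u (L u y) - ((2 * \<alpha>) *\<^sub>R L u y - (\<alpha>\<^sup>2 + \<beta>\<^sup>2) *\<^sub>R y) = 0" if "y \<in> W" for y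
        by (rule schur[of "\<lambda>y. L u (L u y) - ((2 * \<alpha>) *\<^sub>R L u y - (\<alpha>\<^sup>2 + \<beta>\<^sup>2) *\<^sub>R y)" z])
          (use z that commW W(4) in \<open>auto intro!: linearI simp: L_simps algebra_simps\<close>)
      then have "\<forall>y\<in>W. L u (L u y) = (2 * \<alpha>) *\<^sub>R L u y - (\<alpha>\<^sup>2 + \<beta>\<^sup>2) *\<^sub>R y"
        by (metis eq_iff_diff_eq_0)
      then show ?thesis using False by blast
    qed
  qed
  show ?thesis
  proof (cases "\<forall>u. \<exists>c. \<forall>y\<in>W. L u y = c *\<^sub>R y")
    case True
    then show ?thesis using that(1)[of x] x W(3) by meson
  next
    case False
    then obtain u \<alpha> \<beta> where u: "\<beta> \<noteq> 0"
      "\<And>y. y \<in> W \<Longrightarrow> L u (L u y) = (2 * \<alpha>) *\<^sub>R L u y - (\<alpha>\<^sup>2 + \<beta>\<^sup>2) *\<^sub>R y"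
      using quad by meson
    have "\<exists>a b. L v x = a *\<^sub>R x + b *\<^sub>R L u x" for v
      using quad[of v]
    proof
      assume "\<exists>c. \<forall>y\<in>W. L v y = c *\<^sub>R y"
      then obtain c where "L v x = c *\<^sub>R x" using x by blast
      then have "L v x = c *\<^sub>R x + 0 *\<^sub>R L u x" by simp
      then show ?thesis by blast
    next
      assume "\<exists>\<alpha> \<beta>. \<beta> \<noteq> 0 \<and> (\<forall>y\<in>W. L v (L v y) = (2 * \<alpha>) *\<^sub>R L v y - (\<alpha>\<^sup>2 + \<beta>\<^sup>2) *\<^sub>R y)"
      then obtain \<alpha>' \<beta>' where v: "\<beta>' \<noteq> 0"
        "\<And>y. y \<in> W \<Longrightarrow> L v (L v y) = (2 * \<alpha>') *\<^sub>R L v y - (\<alpha>'\<^sup>2 + \<beta>'\<^sup>2) *\<^sub>R y"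
        by blast
      \<comment> \<open>\<open>S s\<close> is \<open>\<beta> \<beta>' (J + s J')\<close>.\<close>
      define S where "S s y = \<beta>' *\<^sub>R (L u y - \<alpha> *\<^sub>R y) + (s * \<beta>) *\<^sub>R (L v y - \<alpha>' *\<^sub>R y)" for s y
      have S0: "\<exists>a b. L v x = a *\<^sub>R x + b *\<^sub>R L u x" if "S s x = 0" "s * s = 1" for s
      proof -
        have "s * \<beta> \<noteq> 0" using that(2) u(1) by auto
        have "(s * \<beta>) *\<^sub>R L v x = (s * \<beta>) *\<^sub>R ((\<alpha>' + \<beta>' * \<alpha> / (s * \<beta>)) *\<^sub>R x + (- \<beta>' / (s * \<beta>)) *\<^sub>R L u x)"
          using that(1) \<open>s * \<beta> \<noteq> 0\<close> unfolding S_def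
          by (simp add: algebra_simps)
        then show ?thesis using \<open>s * \<beta> \<noteq> 0\<close> real_vector.scale_left_imp_eq by blast
      qed
      show ?thesis
      proof (cases "S 1 x = 0")
        case True
        then show ?thesis using S0[of 1] by simp
      next
        case False
        \<comment> \<open>Splits doubled coefficients, so that the cross terms below cancel.\<close>
        have two: "(a * (b * (c * 2))) *\<^sub>R y = (a * (b * c)) *\<^sub>R y + (a * (b * c)) *\<^sub>R y"
          for a b c and y :: 'a
          by (simp flip: scaleR_add_left)
        have "S 1 x \<in> W"
          unfolding S_def using x W by (intro subspace_add subspace_scale subspace_diff) auto
        moreover have "S (- 1) (S 1 x) = 0"
          unfolding S_def
          by (simp add: L_simps u(2)[OF x(1)] v(2)[OF x(1)] commW[OF x(1), of v u])
            (simp add: algebra_simps power2_eq_square two)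
        moreover have "linear (S (- 1))"
          unfolding S_def by (intro linearI) (simp_all add: L_simps algebra_simps)
        moreover have "S (- 1) (L w z) = L w (S (- 1) z)" if "z \<in> W" for w z
          using commW[OF that] unfolding S_def by (simp add: L_simps)
        ultimately have "S (- 1) x = 0" using schur False x(1) by blast
        then show ?thesis using S0[of "- 1"] by simp
      qed
    qed
    then show ?thesis using that(2)[of x \<beta> u \<alpha>] x W(3) u by blast
  qed
qed

section \<open>Pre-symplectic left-symmetric algebras\<close>

text \<open>
  The laws of \<^locale>\<open>pre_symplectic_lsa\<close> for a structure carried by a whole type, stated with type class
  operations so that real linear algebra applies.
\<close>
locale psl_algebra =
  fixes p :: "'a::real_vector \<Rightarrow> 'a \<Rightarrow> 'a" and \<omega> :: "'a \<Rightarrow> 'a \<Rightarrow> real"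
  assumes fd: "finite_dimensional TYPE('a)"
    and p_lin1: "\<And>y. linear (\<lambda>x. p x y)" and p_lin2: "\<And>x. linear (p x)"
    and w_lin1: "\<And>y. linear (\<lambda>x. \<omega> x y)" and w_lin2: "\<And>x. linear (\<omega> x)"
    and left_sym: "\<And>u v w. p (p u v) w - p u (p v w) = p (p v u) w - p v (p u w)"
    and skew: "\<And>u v. \<omega> u v = - \<omega> v u"
    and nondeg: "\<And>u. (\<And>v. \<omega> u v = 0) \<Longrightarrow> u = 0"
    and inv1: "\<And>u v w. \<omega> (p u v) w = \<omega> v (p u w)"
begin

lemmas p_simps = linear_0[OF p_lin1] linear_0[OF p_lin2] linear_add[OF p_lin1] linear_add[OF p_lin2]
  linear_diff[OF p_lin1] linear_diff[OF p_lin2] linear_scale[OF p_lin1] linear_scale[OF p_lin2]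
  linear_neg[OF p_lin1] linear_neg[OF p_lin2]

lemmas w_simps = linear_0[OF w_lin1] linear_0[OF w_lin2] linear_add[OF w_lin1] linear_add[OF w_lin2]
  linear_diff[OF w_lin1] linear_diff[OF w_lin2] linear_scale[OF w_lin1] linear_scale[OF w_lin2]
  linear_neg[OF w_lin1] linear_neg[OF w_lin2]

lemma form_eqI:
  assumes "\<And>z. \<omega> x z = \<omega> y z"
  shows "x = y"
  using nondeg[of "x - y"] assms by (simp add: w_simps)

lemma w_self [simp]: "\<omega> x x = 0"
  using skew[of x x] by simp

text \<open>
  Left symmetry says that \<open>[L u, L v]\<close> is the left multiplication by the commutator of \<open>u\<close> and \<open>v\<close>.
  All left multiplications are symmetric for \<open>\<omega>\<close>, whereas a commutator of symmetric operators is
  antisymmetric; so both sides vanish.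
\<close>
lemma left_mult_commute: "p u (p v w) = p v (p u w)"
  and left_mult_swap: "p (p u v) w = p (p v u) w"
proof -
  define D where "D w = p u (p v w) - p v (p u w)" for w
  have D: "D w = p (p u v) w - p (p v u) w" for w
    using left_sym[of u v w] by (simp add: D_def algebra_simps)
  have "\<omega> (D w) z = 0" for z
  proof -
    have "\<omega> (D w) z = \<omega> w (D z)"
      by (simp add: D w_simps inv1)
    moreover have "\<omega> (D w) z = - \<omega> w (D z)"
      by (simp add: D_def w_simps inv1)
    ultimately show ?thesis by simp
  qed
  then have "D w = 0" by (rule nondeg)
  then show "p u (p v w) = p v (p u w)" "p (p u v) w = p (p v u) w"
    using D[of w] by (simp_all add: D_def)
qed

text \<open>Degeneracy of the commutator ideal means that this subspace is nonzero.\<close>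
definition central_part :: "'a set" where
  "central_part = commutator_ideal p \<inter> perp \<omega> (commutator_ideal p)"

lemma subspace_perp: "Real_Vector_Spaces.subspace (perp \<omega> V)"
  by (auto simp: perp_def Real_Vector_Spaces.subspace_def w_simps)

lemma subspace_central_part: "Real_Vector_Spaces.subspace central_part"
  unfolding central_part_def commutator_ideal_def
  by (intro subspace_inter subspace_span subspace_perp)

lemma commutator_ideal_mult_left: "x \<in> commutator_ideal p \<Longrightarrow> p x w = 0"
  unfolding commutator_ideal_def
  by (induction rule: span_induct_alt) (auto simp: p_simps left_mult_swap)

lemma commutator_ideal_mult_right: "x \<in> commutator_ideal p \<Longrightarrow> p w x \<in> commutator_ideal p"
proof -
  assume x: "x \<in> commutator_ideal p"
  have "p w x - p x w \<in> commutator_ideal p"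
    unfolding commutator_ideal_def by (rule span_base) blast
  then show ?thesis using commutator_ideal_mult_left[OF x] by simp
qed

lemma perp_commutator_swap:
  "x \<in> perp \<omega> (commutator_ideal p) \<Longrightarrow> \<omega> x (p u v) = \<omega> x (p v u)"
proof -
  assume x: "x \<in> perp \<omega> (commutator_ideal p)"
  have "p u v - p v u \<in> commutator_ideal p"
    unfolding commutator_ideal_def by (rule span_base) blast
  then have "\<omega> x (p u v - p v u) = 0" using x by (simp add: perp_def)
  then show ?thesis by (simp add: w_simps)
qed

lemma central_part_mult_left: "x \<in> central_part \<Longrightarrow> p x w = 0"
  by (simp add: central_part_def commutator_ideal_mult_left)

lemma central_part_mult_right: "x \<in> central_part \<Longrightarrow> p w x \<in> central_part"
  by (auto simp: central_part_def perp_def inv1 commutator_ideal_mult_right)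

lemma central_part_swap: "x \<in> central_part \<Longrightarrow> \<omega> x (p u v) = \<omega> x (p v u)"
  by (simp add: central_part_def perp_commutator_swap)

lemma central_part_isotropic: "x \<in> central_part \<Longrightarrow> y \<in> central_part \<Longrightarrow> \<omega> x y = 0"
  by (simp add: central_part_def perp_def)

text \<open>
  Paired with any \<open>b\<close>, both sides become values of \<open>\<omega> y\<close> at a triple product of \<open>v\<close>, \<open>w\<close> and \<open>b\<close>;
  orthogonality to the commutators and commutation of left multiplications permute the three factors.
\<close>
lemma central_part_mult_mult:
  assumes y: "y \<in> central_part"
  shows "p (p v w) y = p v (p w y)"
proof (rule form_eqI)
  fix b
  have "\<omega> (p (p v w) y) b = \<omega> y (p b (p v w))"
    by (simp add: inv1 central_part_swap[OF y, of "p v w"])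
  also have "\<dots> = \<omega> (p v y) (p b w)"
    by (simp add: inv1 left_mult_commute[of b])
  also have "\<dots> = \<omega> (p w (p v y)) b"
    using central_part_swap[OF central_part_mult_right[OF y, of v], of b w]
    by (simp add: inv1[of w])
  finally show "\<omega> (p (p v w) y) b = \<omega> (p v (p w y)) b"
    by (simp add: left_mult_commute)
qed

end

section \<open>Darboux frames of ideals\<close>

text \<open>
  The vectors \<open>ii j\<close> span the ideal, and the \<open>dd j\<close> span an isotropic complement of its orthogonal,
  dual to the ideal under \<open>\<omega>\<close>.
\<close>
locale darboux_frame = psl_algebra p \<omega>
  for p :: "'a::real_vector \<Rightarrow> 'a \<Rightarrow> 'a" and \<omega> :: "'a \<Rightarrow> 'a \<Rightarrow> real" +
  fixes J :: "nat set" and dd ii :: "nat \<Rightarrow> 'a"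
  assumes finite_J: "finite J"
    and w_ii_dd: "\<And>j k. j \<in> J \<Longrightarrow> k \<in> J \<Longrightarrow> \<omega> (ii j) (dd k) = (if j = k then 1 else 0)"
    and w_dd_dd: "\<And>j k. j \<in> J \<Longrightarrow> k \<in> J \<Longrightarrow> \<omega> (dd j) (dd k) = 0"
    and ii_central: "\<And>j. j \<in> J \<Longrightarrow> ii j \<in> central_part"
    and ii_ideal: "\<And>u j. j \<in> J \<Longrightarrow> p u (ii j) \<in> span (ii ` J)"
begin

definition ideal :: "'a set" where "ideal = span (ii ` J)"

text \<open>
  The projections onto the span of the \<open>dd j\<close>, onto the ideal, and onto the orthogonal of both: the
  components in \<open>\<h>\<close>, \<open>\<h>\<^sup>*\<close> and \<open>\<B>\<close>.
\<close>
definition Ph :: "'a \<Rightarrow> 'a" where "Ph x = (\<Sum>j\<in>J. \<omega> (ii j) x *\<^sub>R dd j)"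

definition PI :: "'a \<Rightarrow> 'a" where "PI x = (\<Sum>j\<in>J. \<omega> x (dd j) *\<^sub>R ii j)"

definition PB :: "'a \<Rightarrow> 'a" where "PB x = x - Ph x - PI x"

end

text \<open>
  The cocycle identity is condition B4 for \<open>L a b c = \<omega> (p a b) c\<close>.  Commutation of left
  multiplications gives it only up to \<open>\<omega> (\<theta> a c) (\<theta> b l) - \<omega> (\<theta> b c) (\<theta> a l)\<close>, where
  \<open>\<theta> x y = PB (p x y)\<close>, and this term varies with the frame; so the identity is a requirement on the
  choice of the frame.
\<close>
locale balanced_frame = darboux_frame +
  assumes cocycle: "\<And>a b c l. Ph a = a \<Longrightarrow> Ph b = b \<Longrightarrow> Ph c = c \<Longrightarrow> Ph l = l \<Longrightarrow>
    \<omega> (p a (Ph (p b c))) l - \<omega> (p b (Ph (p a c))) l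
      = - \<omega> (p a (Ph (p b l))) c + \<omega> (p b (Ph (p a l))) c"

context psl_algebra
begin

text \<open>
  On a line \<open>\<omega> (p a b) c\<close> is a multiple of \<open>\<omega> (p d d) d\<close>, which vanishes because \<open>p d\<close> is symmetric
  and \<open>\<omega>\<close> alternating.
\<close>
lemma line_frame_exists:
  assumes x: "x \<in> central_part" "x \<noteq> 0" and inv: "\<And>u. \<exists>c. p u x = c *\<^sub>R x"
  shows "\<exists>dd ii. balanced_frame p \<omega> {1} dd ii"
proof -
  note One_nat_def [simp del]
  obtain w where w: "\<omega> x w \<noteq> 0" using nondeg x(2) by blast
  define d where "d = (1 / \<omega> x w) *\<^sub>R w"
  have xd: "\<omega> x d = 1" using w by (simp add: d_def w_simps)
  interpret darboux_frame p \<omega> "{1}" "\<lambda>_. d" "\<lambda>_. x"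
  proof
    fix u
    obtain c where "p u x = c *\<^sub>R x" using inv by blast
    then show "p u x \<in> span ((\<lambda>_. x) ` {1::nat})"
      by (auto simp: span_singleton)
  qed (use x xd in auto)
  have ddd: "\<omega> (p d d) d = 0"
    using inv1[of d d d] skew[of d "p d d"] by simp
  have "\<omega> (p a b) c = 0" if "Ph a = a" "Ph b = b" "Ph c = c" for a b c
  proof -
    have "a = \<omega> x a *\<^sub>R d" "b = \<omega> x b *\<^sub>R d" "c = \<omega> x c *\<^sub>R d"
      using that by (simp_all add: Ph_def)
    then show ?thesis using ddd by (metis (no_types) p_simps(7,8) w_simps(7,8) scaleR_zero_right)
  qed
  moreover have "Ph (Ph z) = Ph z" for z
    by (simp add: Ph_def w_simps xd)
  ultimately have "balanced_frame p \<omega> {1} (\<lambda>_. d) (\<lambda>_. x)"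
    by unfold_locales simp
  then show ?thesis by blast
qed

text \<open>
  On the plane spanned by \<open>x\<close> and \<open>p u x\<close> the operator \<open>p u\<close> acts as the complex number
  \<open>\<alpha> + \<i> \<beta>\<close>, and suitable \<open>e\<close> and \<open>d\<^sub>0\<close> act as \<open>1\<close> and \<open>\<i>\<close>.  The lift \<open>d = p d\<^sub>0 e\<close> of \<open>\<i>\<close> is chosen so that
  \<open>\<omega> e d\<close> and \<open>\<omega> (p e e) d\<close> are both of the form \<open>\<omega> z (S z)\<close> with \<open>S\<close> symmetric, and vanish.
  Consequently \<open>\<omega> (p a b) c\<close>, for \<open>a\<close>, \<open>b\<close>, \<open>c\<close> in the span of \<open>e\<close> and \<open>d\<close>, depends on \<open>a\<close> through
  its imaginary part alone, and the cocycle identity becomes an identity between complex numbers.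
\<close>
lemma plane_frame_exists:
  assumes x: "x \<in> central_part" "x \<noteq> 0" and \<beta>: "\<beta> \<noteq> 0"
    and quad: "p u (p u x) = (2 * \<alpha>) *\<^sub>R p u x - (\<alpha>\<^sup>2 + \<beta>\<^sup>2) *\<^sub>R x"
    and inv: "\<And>v. \<exists>a b. p v x = a *\<^sub>R x + b *\<^sub>R p u x"
  shows "\<exists>dd ii. balanced_frame p \<omega> {1, 2} dd ii"
proof -
  note One_nat_def [simp del]
  define T where "T = \<alpha>\<^sup>2 + \<beta>\<^sup>2"
  have T: "T \<noteq> 0" using \<beta> unfolding T_def by (simp add: sum_power2_eq_zero_iff)
  \<comment> \<open>\<open>p u\<close> acts as \<open>z = \<alpha> + \<i> \<beta>\<close> and \<open>p u u\<close> as \<open>z\<^sup>2 = 2 \<alpha> z - T\<close>, which expresses \<open>1\<close> through both.\<close>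
  define e where "e = (1 / T) *\<^sub>R ((2 * \<alpha>) *\<^sub>R u - p u u)"
  define d\<^sub>0 where "d\<^sub>0 = (1 / \<beta>) *\<^sub>R (u - \<alpha> *\<^sub>R e)"
  define d where "d = p d\<^sub>0 e"
  define y where "y = p d x"
  have ex: "p e x = x"
    using T by (simp add: e_def p_simps central_part_mult_mult[OF x(1)] quad T_def[symmetric])
  have d0x: "p d\<^sub>0 x = (1 / \<beta>) *\<^sub>R (p u x - \<alpha> *\<^sub>R x)"
    by (simp add: d\<^sub>0_def p_simps ex)
  have y: "y = (1 / \<beta>) *\<^sub>R (p u x - \<alpha> *\<^sub>R x)"
    unfolding y_def d_def by (simp add: central_part_mult_mult[OF x(1)] ex d0x)
  have yZ: "y \<in> central_part"
    unfolding y_def by (rule central_part_mult_right[OF x(1)])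
  have ey: "p e y = y"
    unfolding y_def by (subst left_mult_commute) (simp add: ex)
  have dy: "p d y = - x"
  proof -
    have "p d y = p d\<^sub>0 y"
      unfolding d_def by (simp add: central_part_mult_mult[OF yZ] ey)
    also have "\<dots> = (1 / \<beta>) *\<^sub>R (p u y - \<alpha> *\<^sub>R y)"
      by (simp add: d\<^sub>0_def p_simps ey)
    also have "p u y = (1 / \<beta>) *\<^sub>R (\<alpha> *\<^sub>R p u x - T *\<^sub>R x)"
      by (simp add: y p_simps quad T_def[symmetric]) (simp add: algebra_simps flip: scaleR_add_left)
    also have "(1 / \<beta>) *\<^sub>R ((1 / \<beta>) *\<^sub>R (\<alpha> *\<^sub>R p u x - T *\<^sub>R x) - \<alpha> *\<^sub>R y) = - ((1 / \<beta>) * (1 / \<beta>) * \<beta>\<^sup>2) *\<^sub>R x"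
      by (simp add: y T_def algebra_simps power2_eq_square)
    also have "\<dots> = - x" using \<beta> by (simp add: power2_eq_square)
    finally show ?thesis .
  qed
  have invd: "\<exists>a b. p v x = a *\<^sub>R x + b *\<^sub>R y" for v
  proof -
    obtain a b where "p v x = a *\<^sub>R x + b *\<^sub>R p u x" using inv by blast
    also have "p u x = \<alpha> *\<^sub>R x + \<beta> *\<^sub>R y" using \<beta> by (simp add: y)
    finally have "p v x = (a + b * \<alpha>) *\<^sub>R x + (b * \<beta>) *\<^sub>R y" by (simp add: algebra_simps)
    then show ?thesis by blast
  qed
  have ed: "\<omega> e d = 0"
    using inv1[of d\<^sub>0 e e] skew[of e d] by (simp add: d_def)
  have eed: "\<omega> (p e e) d = 0"
  proof -
    have "\<omega> (p e e) d = \<omega> d (p e e)"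
      unfolding d_def by (simp add: inv1 left_mult_commute[of e])
    then show ?thesis using skew[of d "p e e"] by simp
  qed
  \<comment> \<open>The pairing of \<open>x\<close>, \<open>y\<close> with \<open>e\<close>, \<open>d\<close> has the rows \<open>(P, Q)\<close> and \<open>(Q, - P)\<close>; inverting it gives
    the dual basis \<open>i\<close>, \<open>k\<close>.\<close>
  define P where "P = \<omega> x e"
  define Q where "Q = \<omega> x d"
  have ye: "\<omega> y e = Q"
  proof -
    have "\<omega> y e = \<omega> x (p e d)"
      unfolding y_def by (simp add: inv1 central_part_swap[OF x(1), of d])
    also have "\<dots> = Q" by (simp add: inv1[symmetric] ex Q_def)
    finally show ?thesis .
  qed
  have yd: "\<omega> y d = - P"
  proof -
    have "\<omega> y d = \<omega> y (p d e)"
      by (metis ey inv1 central_part_swap[OF yZ])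
    also have "\<dots> = - P" by (simp add: inv1[symmetric] dy P_def w_simps)
    finally show ?thesis .
  qed
  define N where "N = P\<^sup>2 + Q\<^sup>2"
  have N: "N \<noteq> 0"
  proof
    assume "N = 0"
    then have PQ: "P = 0" "Q = 0" by (simp_all add: N_def sum_power2_eq_zero_iff)
    have "\<omega> x v = 0" for v
    proof -
      obtain a b where ab: "p v x = a *\<^sub>R x + b *\<^sub>R y" using invd by blast
      have "\<omega> x v = \<omega> (p v x) e"
        by (metis ex inv1 central_part_swap[OF x(1)])
      also have "\<dots> = 0" using PQ by (simp add: ab w_simps ye P_def[symmetric])
      finally show ?thesis .
    qed
    then show False using nondeg x(2) by blast
  qed
  define i where "i = (1 / N) *\<^sub>R (P *\<^sub>R x + Q *\<^sub>R y)"
  define k where "k = (1 / N) *\<^sub>R (Q *\<^sub>R x - P *\<^sub>R y)"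
  have frame: "\<omega> i e = 1" "\<omega> i d = 0" "\<omega> k e = 0" "\<omega> k d = 1"
    using N by (simp_all add: i_def k_def w_simps ye yd P_def[symmetric] Q_def[symmetric] N_def
        power2_eq_square) 
  have act: "p e i = i" "p e k = k" "p d i = - k" "p d k = i"
    by (simp_all add: i_def k_def p_simps ex ey dy y_def[symmetric] algebra_simps)
  have ik: "i \<in> central_part" "k \<in> central_part"
    unfolding i_def k_def using x(1) yZ
    by (auto intro!: subspace_add subspace_diff subspace_scale subspace_central_part)
  have inv_ik: "p v i \<in> span {i, k} \<and> p v k \<in> span {i, k}" for v
  proof -
    obtain a b where ab: "p v x = a *\<^sub>R x + b *\<^sub>R y" using invd by blast
    have vy: "p v y = a *\<^sub>R y - b *\<^sub>R x"
      unfolding y_def by (simp add: left_mult_commute[of v] ab p_simps dy[unfolded y_def] y_def)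
    have "p v i = a *\<^sub>R i - b *\<^sub>R k" "p v k = a *\<^sub>R k + b *\<^sub>R i"
      by (simp_all add: i_def k_def p_simps ab vy algebra_simps)
    moreover have "i \<in> span {i, k}" "k \<in> span {i, k}"
      by (simp_all add: span_base)
    ultimately show ?thesis
      by (simp add: span_add span_diff span_scale)
  qed
  define dd where "dd j = (if j = 1 then e else d)" for j :: nat
  define ii where "ii j = (if j = 1 then i else k)" for j :: nat
  interpret darboux_frame p \<omega> "{1, 2}" dd ii
  proof
    have de: "\<omega> d e = 0" using skew[of d e] ed by simp
    have im: "ii ` {1, 2} = {i, k}" by (auto simp: ii_def)
    show "finite {1, 2 :: nat}" by simp
    show "\<omega> (ii j) (dd l) = (if j = l then 1 else 0)" if "j \<in> {1, 2}" "l \<in> {1, 2}" for j l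
      using that frame by (auto simp: dd_def ii_def)
    show "\<omega> (dd j) (dd l) = 0" if "j \<in> {1, 2}" "l \<in> {1, 2}" for j l
      using that ed de by (auto simp: dd_def)
    show "ii j \<in> central_part" if "j \<in> {1, 2}" for j
      using ik by (simp add: ii_def)
    show "p u (ii j) \<in> span (ii ` {1, 2})" if "j \<in> {1, 2}" for u j
      unfolding im using inv_ik by (simp add: ii_def)
  qed
  have Ph: "Ph z = \<omega> i z *\<^sub>R e + \<omega> k z *\<^sub>R d" for z
    by (simp add: Ph_def dd_def ii_def)
  have Ph_Ph: "Ph (Ph z) = Ph z" for z
    by (simp add: Ph w_simps frame)
  define m where "m = \<omega> (p d e) d"
  have dde: "\<omega> (p d d) e = - m" "\<omega> (p d e) e = 0" "\<omega> (p d d) d = 0"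
    using skew[of d "p d e"] inv1[of d d e] inv1[of d e e] skew[of e "p d e"]
      inv1[of d d d] skew[of d "p d d"] by (simp_all add: m_def)
  have ede: "\<omega> (p e d) e = 0" "\<omega> (p e e) e = 0" "\<omega> (p e d) d = 0"
    using skew[of d "p e e"] inv1[of e d e] eed skew[of e "p e e"] inv1[of e e e]
      skew[of d "p e d"] inv1[of e d d] by simp_all
  have tri: "\<omega> (p a b) c = \<omega> k a * m * (\<omega> i b * \<omega> k c - \<omega> k b * \<omega> i c)"
    if "Ph a = a" "Ph b = b" "Ph c = c" for a b c
  proof -
    have "\<omega> (p a b) c = \<omega> (p (Ph a) (Ph b)) (Ph c)" using that by simp
    also have "\<dots> = \<omega> k a * m * (\<omega> i b * \<omega> k c - \<omega> k b * \<omega> i c)"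
      by (simp add: Ph p_simps w_simps dde ede eed m_def[symmetric] algebra_simps)
    finally show ?thesis .
  qed
  \<comment> \<open>In the coordinates \<open>\<omega> i\<close>, \<open>\<omega> k\<close> the product is that of complex numbers.\<close>
  have prod: "\<omega> i (p a b) = \<omega> i a * \<omega> i b - \<omega> k a * \<omega> k b"
    "\<omega> k (p a b) = \<omega> i a * \<omega> k b + \<omega> k a * \<omega> i b" if "Ph a = a" for a b
  proof -
    have "\<omega> i (p (Ph a) b) = \<omega> i a * \<omega> i b - \<omega> k a * \<omega> k b"
      by (simp add: inv1[symmetric] Ph p_simps w_simps act)
    then show "\<omega> i (p a b) = \<omega> i a * \<omega> i b - \<omega> k a * \<omega> k b" using that by simp
    have "\<omega> k (p (Ph a) b) = \<omega> i a * \<omega> k b + \<omega> k a * \<omega> i b"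
      by (simp add: inv1[symmetric] Ph p_simps w_simps act)
    then show "\<omega> k (p a b) = \<omega> i a * \<omega> k b + \<omega> k a * \<omega> i b" using that by simp
  qed
  have coord: "\<omega> i (Ph z) = \<omega> i z" "\<omega> k (Ph z) = \<omega> k z" for z
    by (simp_all add: Ph w_simps frame)
  have "balanced_frame p \<omega> {1, 2} dd ii"
  proof
    fix a b c l assume h: "Ph a = a" "Ph b = b" "Ph c = c" "Ph l = l"
    have quart: "\<omega> (p a (Ph (p b c))) l = \<omega> k a * m *
        ((\<omega> i b * \<omega> i c - \<omega> k b * \<omega> k c) * \<omega> k l - (\<omega> i b * \<omega> k c + \<omega> k b * \<omega> i c) * \<omega> i l)"
      if "Ph a = a" "Ph b = b" "Ph l = l" for a b c l
      using tri[OF that(1) Ph_Ph that(3)] by (simp only: coord prod[OF that(2)])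
    show "\<omega> (p a (Ph (p b c))) l - \<omega> (p b (Ph (p a c))) l
        = - \<omega> (p a (Ph (p b l))) c + \<omega> (p b (Ph (p a l))) c"
      unfolding quart[OF h(1,2,4)] quart[OF h(2,1,4)] quart[OF h(1,2,3)] quart[OF h(2,1,3)]
      by (simp add: algebra_simps)
  qed
  then show ?thesis by blast
qed

theorem balanced_frame_exists:
  assumes "degenerate \<omega> (commutator_ideal p)"
  shows "\<exists>J dd ii. (J = {1} \<or> J = {1, 2}) \<and> balanced_frame p \<omega> J dd ii"
proof -
  have "central_part \<noteq> {0}" using assms by (simp add: degenerate_def central_part_def)
  note W = fd p_lin2 subspace_central_part this central_part_mult_right left_mult_commute
  show ?thesis
  proof (rule commuting_real_operators_small_invariant_subspace[where L = p, OF W])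
    fix x assume "x \<in> central_part" "x \<noteq> 0" "\<And>u. \<exists>c. p u x = c *\<^sub>R x"
    from line_frame_exists[OF this] show ?thesis by blast
  next
    fix x u \<alpha> \<beta>
    assume "x \<in> central_part" "x \<noteq> 0" "\<beta> \<noteq> 0"
      "p u (p u x) = (2 * \<alpha>) *\<^sub>R p u x - (\<alpha>\<^sup>2 + \<beta>\<^sup>2) *\<^sub>R x"
      "\<And>v. \<exists>a b. p v x = a *\<^sub>R x + b *\<^sub>R p u x"
    from plane_frame_exists[OF this] show ?thesis by blast
  qed
qed

end

section \<open>Spaces modelled on subspaces of a real vector space\<close>

text \<open>
  A structure \<open>V\<close> whose operations are carried to those of a real vector space by an injection \<open>s\<close>
  inherits all the vector space axioms.  This serves to compute with cosets through the representatives
  singled out by a frame.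
\<close>
locale concrete_space =
  fixes V :: "(real, 'v) module" (structure) and s :: "'v \<Rightarrow> 'a::real_vector" and S :: "'a set"
  assumes s_bij: "bij_betw s (carrier V) S"
    and zero_closed: "\<zero> \<in> carrier V" and s_zero: "s \<zero> = 0"
    and add_closed: "\<And>x y. x \<in> carrier V \<Longrightarrow> y \<in> carrier V \<Longrightarrow> x \<oplus> y \<in> carrier V"
    and s_add: "\<And>x y. x \<in> carrier V \<Longrightarrow> y \<in> carrier V \<Longrightarrow> s (x \<oplus> y) = s x + s y"
    and smult_closed: "\<And>c x. x \<in> carrier V \<Longrightarrow> c \<odot> x \<in> carrier V"
    and s_smult: "\<And>c x. x \<in> carrier V \<Longrightarrow> s (c \<odot> x) = c *\<^sub>R s x"
begin

definition r :: "'a \<Rightarrow> 'v" where "r = the_inv_into (carrier V) s"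

lemma s_inj: "inj_on s (carrier V)" and s_image: "s ` carrier V = S"
  using s_bij by (auto simp: bij_betw_def)

lemma s_eqI: "x \<in> carrier V \<Longrightarrow> y \<in> carrier V \<Longrightarrow> s x = s y \<Longrightarrow> x = y"
  using s_inj by (auto dest: inj_onD)

lemma s_mem: "x \<in> carrier V \<Longrightarrow> s x \<in> S"
  using s_image by blast

lemma r_closed: "a \<in> S \<Longrightarrow> r a \<in> carrier V"
  unfolding r_def by (rule the_inv_into_into[OF s_inj]) (simp_all add: s_image)

lemma s_r: "a \<in> S \<Longrightarrow> s (r a) = a"
  unfolding r_def by (rule f_the_inv_into_f[OF s_inj]) (simp add: s_image)

lemma r_s: "x \<in> carrier V \<Longrightarrow> r (s x) = x"
  unfolding r_def by (rule the_inv_into_f_f[OF s_inj])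

lemma subspace_S: "Real_Vector_Spaces.subspace S"
proof -
  have "0 \<in> S" using s_mem[OF zero_closed] s_zero by simp
  moreover have "a + b \<in> S" if "a \<in> S" "b \<in> S" for a b
    using s_mem[OF add_closed[OF r_closed r_closed]] that by (metis s_add r_closed s_r)
  moreover have "c *\<^sub>R a \<in> S" if "a \<in> S" for a c
    using s_mem[OF smult_closed[OF r_closed]] that by (metis s_smult r_closed s_r)
  ultimately show ?thesis by (simp add: Real_Vector_Spaces.subspace_def)
qed

lemma abelian_group: "abelian_group V"
proof (rule abelian_groupI)
  fix x assume x: "x \<in> carrier V"
  have "(- 1) \<odot> x \<oplus> x = \<zero>"
    by (rule s_eqI) (simp_all add: x add_closed smult_closed zero_closed s_add s_smult s_zero)
  then show "\<exists>y\<in>carrier V. y \<oplus> x = \<zero>" using x smult_closed by blast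
qed (auto intro!: s_eqI simp: add_closed zero_closed s_add s_zero algebra_simps)

lemma vectorspace: "vectorspace reals_ring V"
proof -
  have "cring reals_ring"
    using class_field field.axioms(1) domain.axioms(1) by blast
  then have "Module.module reals_ring V"
    by (rule moduleI[OF _ abelian_group])
      (auto intro!: s_eqI simp: add_closed smult_closed s_add s_smult algebra_simps)
  then show ?thesis
    by (simp add: vectorspace_def class_field)
qed

lemma s_a_inv: "x \<in> carrier V \<Longrightarrow> s (\<ominus> x) = - s x"
  and a_inv_closed: "x \<in> carrier V \<Longrightarrow> \<ominus> x \<in> carrier V"
proof -
  interpret G: abelian_group V by (rule abelian_group)
  assume x: "x \<in> carrier V"
  show c: "\<ominus> x \<in> carrier V" using x by (rule G.a_inv_closed)
  have "s (\<ominus> x \<oplus> x) = 0" using x by (simp add: G.l_neg s_zero)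
  then show "s (\<ominus> x) = - s x" using x c by (simp add: s_add eq_neg_iff_add_eq_0)
qed

lemma minus_closed: "x \<in> carrier V \<Longrightarrow> y \<in> carrier V \<Longrightarrow> x \<ominus> y \<in> carrier V"
  and s_minus: "x \<in> carrier V \<Longrightarrow> y \<in> carrier V \<Longrightarrow> s (x \<ominus> y) = s x - s y"
  by (simp_all add: a_minus_def add_closed a_inv_closed s_add s_a_inv)

lemmas s_simps = zero_closed s_zero add_closed s_add smult_closed s_smult a_inv_closed s_a_inv
  minus_closed s_minus

lemma s_lincomb:
  assumes "finite A" "A \<subseteq> carrier V"
  shows "LinearCombinations.module.lincomb V c A \<in> carrier V"
    and "s (LinearCombinations.module.lincomb V c A) = (\<Sum>v\<in>A. c v *\<^sub>R s v)"
proof -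
  interpret VS: vectorspace reals_ring V by (rule vectorspace)
  have "VS.lincomb c A \<in> carrier V \<and> s (VS.lincomb c A) = (\<Sum>v\<in>A. c v *\<^sub>R s v)"
    using assms
  proof (induction A)
    case empty
    then show ?case by (simp add: VS.lincomb_def s_zero)
  next
    case (insert x A)
    have "VS.lincomb c (insert x A) = c x \<odot> x \<oplus> VS.lincomb c A"
      unfolding VS.lincomb_def
      by (rule VS.finsum_insert) (use insert in \<open>auto intro!: smult_closed\<close>)
    then show ?case using insert by (simp add: s_simps)
  qed
  then show "VS.lincomb c A \<in> carrier V" "s (VS.lincomb c A) = (\<Sum>v\<in>A. c v *\<^sub>R s v)"
    by blast+
qed

lemma basisI:
  assumes A: "finite A" "A \<subseteq> carrier V" and ind: "independent (s ` A)" and sp: "span (s ` A) = S"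
  shows "vectorspace.basis reals_ring V A"
proof -
  interpret VS: vectorspace reals_ring V by (rule vectorspace)
  have inj: "inj_on s A" using s_inj A(2) inj_on_subset by blast
  have "VS.lin_indpt A"
  proof
    assume "VS.lin_dep A"
    then obtain c v where c: "VS.lincomb c A = \<zero>" "v \<in> A" "c v \<noteq> 0"
      using VS.finite_lin_dep[OF A(1) _ A(2)] by auto
    define d where "d x = c (the_inv_into A s x)" for x
    have dc: "d (s w) = c w" if "w \<in> A" for w
      using that inj by (simp add: d_def the_inv_into_f_f)
    have "(\<Sum>x\<in>s ` A. d x *\<^sub>R x) = (\<Sum>w\<in>A. c w *\<^sub>R s w)"
      by (subst sum.reindex[OF inj]) (simp add: dc)
    also have "\<dots> = 0" using s_lincomb(2)[OF A, of c] c(1) s_zero by simp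
    finally have "d (s v) = 0"
      using independentD[OF ind finite_imageI[OF A(1)] order.refl] c(2) by blast
    then show False using dc c by simp
  qed
  moreover have "VS.span A = carrier V"
  proof
    show "VS.span A \<subseteq> carrier V"
      unfolding VS.finite_span[OF A] using s_lincomb(1)[OF A] by blast
    show "carrier V \<subseteq> VS.span A"
    proof
      fix v assume v: "v \<in> carrier V"
      then have "s v \<in> span (s ` A)" using sp s_mem by blast
      then obtain d where "s v = (\<Sum>x\<in>s ` A. d x *\<^sub>R x)"
        using span_finite[OF finite_imageI[OF A(1)], of s] by auto
      also have "\<dots> = (\<Sum>w\<in>A. d (s w) *\<^sub>R s w)"
        by (subst sum.reindex[OF inj]) simp
      finally have "v = VS.lincomb (\<lambda>w. d (s w)) A"
        using s_lincomb[OF A, of "\<lambda>w. d (s w)"] v by (metis s_eqI)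
      then show "v \<in> VS.span A" unfolding VS.finite_span[OF A] by auto
    qed
  qed
  ultimately show ?thesis using A(2) by (simp add: VS.basis_def)
qed

lemma fin_dim_space:
  assumes "finite_dimensional TYPE('a)"
  shows "fin_dim_space V"
proof -
  interpret VS: vectorspace reals_ring V by (rule vectorspace)
  obtain T :: "'a set" where T: "finite T" "span T = UNIV"
    using assms unfolding finite_dimensional_def by blast
  obtain B where B: "B \<subseteq> S" "independent B" "S \<subseteq> span B"
    using real_vector.maximal_independent_subset[of S] by blast
  have fB: "finite B" using independent_span_bound[OF T(1) B(2)] T(2) by blast
  have sr: "s ` r ` B = B" using B(1) s_r by force
  have "span B = S" using B span_minimal[OF B(1) subspace_S] by blast
  then have "VS.basis (r ` B)"
    using B fB sr r_closed by (intro basisI) auto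
  then have "VS.fin_dim"
    unfolding VS.fin_dim_def VS.basis_def using fB by blast
  then show ?thesis
    by (simp add: fin_dim_space_def vectorspace)
qed

end

lemma linear_mapsI:
  assumes "concrete_space V s S" "concrete_space W t T" "linear g"
    and f: "\<And>v. v \<in> carrier V \<Longrightarrow> f v \<in> carrier W" "\<And>v. v \<in> carrier V \<Longrightarrow> t (f v) = g (s v)"
  shows "f \<in> linear_maps V W"
proof -
  interpret V: concrete_space V s S by fact
  interpret W: concrete_space W t T by fact
  show ?thesis
    unfolding LinearCombinations.module_hom_def using f
    by (auto intro!: W.s_eqI simp: V.s_simps W.s_simps linear_add[OF assms(3)] linear_scale[OF assms(3)])
qed

lemma bilinear_mapI:
  assumes "concrete_space U r R" "concrete_space V s S" "concrete_space W t T"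
    and "\<And>x. linear (g x)" "\<And>y. linear (\<lambda>x. g x y)"
    and f: "\<And>u v. u \<in> carrier U \<Longrightarrow> v \<in> carrier V \<Longrightarrow> f u v \<in> carrier W"
      "\<And>u v. u \<in> carrier U \<Longrightarrow> v \<in> carrier V \<Longrightarrow> t (f u v) = g (r u) (s v)"
  shows "bilinear_map U V W f"
  unfolding bilinear_map_def
proof (intro conjI ballI)
  show "(\<lambda>v. f u v) \<in> linear_maps V W" if "u \<in> carrier U" for u
    by (rule linear_mapsI[OF assms(2,3) assms(4)[of "r u"]]) (use that f in simp_all)
  show "(\<lambda>u. f u v) \<in> linear_maps U W" if "v \<in> carrier V" for v
    by (rule linear_mapsI[OF assms(1,3) assms(5)[of "s v"]]) (use that f in simp_all)
qed

lemma concrete_space_type_algebra: "concrete_space (type_algebra p) id UNIV"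
  by unfold_locales (auto simp: type_algebra_def bij_betw_def)

lemma linear_if_linear_maps: "f \<in> linear_maps (type_algebra p) (type_algebra q) \<Longrightarrow> linear f"
  by (intro linearI) (auto simp: LinearCombinations.module_hom_def type_algebra_def)

lemma finite_dimensional_if_fin_dim_space:
  assumes "fin_dim_space (type_algebra p :: (real, 'a::real_vector) module)"
  shows "finite_dimensional TYPE('a)"
proof -
  interpret C: concrete_space "type_algebra p :: (real, 'a) module" id UNIV
    by (rule concrete_space_type_algebra)
  interpret VS: vectorspace reals_ring "type_algebra p :: (real, 'a) module" by (rule C.vectorspace)
  obtain A where A: "finite A" "A \<subseteq> carrier (type_algebra p)" "VS.span A = carrier (type_algebra p)"
    using assms unfolding fin_dim_space_def VS.fin_dim_def by blast
  have "x \<in> span A" for x :: 'a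
  proof -
    have "x \<in> VS.span A" unfolding A(3) by (simp add: type_algebra_def)
    then obtain c where "x = VS.lincomb c A" unfolding VS.finite_span[OF A(1,2)] by blast
    then have "x = (\<Sum>v\<in>A. c v *\<^sub>R v)" using C.s_lincomb(2)[OF A(1,2), of c] by simp
    then show ?thesis by (simp add: span_sum span_scale span_base)
  qed
  then show ?thesis unfolding finite_dimensional_def using A(1) by blast
qed

lemma psl_algebra_if_pre_symplectic_lsa:
  assumes "pre_symplectic_lsa (type_algebra p) \<omega>"
  shows "psl_algebra p \<omega>"
proof -
  interpret P: pre_symplectic_lsa "type_algebra p" \<omega> by fact
  interpret C: concrete_space "type_algebra p" id UNIV by (rule concrete_space_type_algebra)
  have [simp]: "carrier (type_algebra p) = UNIV" "x \<otimes>\<^bsub>type_algebra p\<^esub> y = p x y"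
    "\<zero>\<^bsub>type_algebra p\<^esub> = 0" "x \<ominus>\<^bsub>type_algebra p\<^esub> y = x - y" for x y
    using C.s_minus[of x y] by (simp_all add: type_algebra_def)
  show ?thesis
  proof (rule psl_algebra.intro)
    show "finite_dimensional TYPE('a)"
      by (rule finite_dimensional_if_fin_dim_space[OF P.space])
    show "linear (\<lambda>x. p x y)" "linear (p y)" for y
      using P.product_bilinear by (auto simp: bilinear_map_def intro!: linear_if_linear_maps[where p = p and q = p])
    show "linear (\<lambda>x. \<omega> x y)" "linear (\<omega> y)" for y
      using P.form_bilinear by (auto simp: bilinear_map_def intro!: linear_if_linear_maps[where p = p and q = "(*)"])
    show "p (p u v) w - p u (p v w) = p (p v u) w - p v (p u w)" for u v w
      using P.left_symmetric[of u v w] by simp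
    show "\<omega> u v = - \<omega> v u" for u v using P.form_skew[of u v] by simp
    fix u assume "\<And>v. \<omega> u v = 0"
    then show "u = 0" using P.form_nondegenerate[of u] by simp
  next
    show "\<omega> (p u v) w = \<omega> v (p u w)" for u v w using P.form_invariant[of u v w] by simp
  qed
qed

section \<open>The three components of an algebra with a Darboux frame\<close>

context darboux_frame
begin

lemma Ph_lin: "linear Ph" and PI_lin: "linear PI"
  unfolding Ph_def PI_def
  by (intro linearI; simp add: w_simps scaleR_add_left sum.distrib scaleR_sum_right)+

lemma PB_lin: "linear PB"
  unfolding PB_def by (intro linearI)
    (simp_all add: linear_add[OF Ph_lin] linear_add[OF PI_lin] linear_scale[OF Ph_lin]
      linear_scale[OF PI_lin] algebra_simps)

lemmas proj_simps =
  linear_0[OF Ph_lin] linear_add[OF Ph_lin] linear_diff[OF Ph_lin] linear_scale[OF Ph_lin] linear_neg[OF Ph_lin]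
  linear_0[OF PB_lin] linear_add[OF PB_lin] linear_diff[OF PB_lin] linear_scale[OF PB_lin] linear_neg[OF PB_lin]
  linear_0[OF PI_lin] linear_add[OF PI_lin] linear_diff[OF PI_lin] linear_scale[OF PI_lin] linear_neg[OF PI_lin]

lemma w_ii_ii: "j \<in> J \<Longrightarrow> k \<in> J \<Longrightarrow> \<omega> (ii j) (ii k) = 0"
  by (simp add: central_part_isotropic ii_central)

lemma w_sum_left: "\<omega> (\<Sum>j\<in>A. f j) y = (\<Sum>j\<in>A. \<omega> (f j) y)"
  by (rule linear_sum[OF w_lin1])

lemma w_sum_right: "\<omega> x (\<Sum>j\<in>A. f j) = (\<Sum>j\<in>A. \<omega> x (f j))"
  by (rule linear_sum[OF w_lin2])

lemma w_ii_Ph: "j \<in> J \<Longrightarrow> \<omega> (ii j) (Ph x) = \<omega> (ii j) x"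
  using finite_J by (simp add: Ph_def w_sum_right w_simps w_ii_dd if_distrib cong: if_cong)

lemma Ph_Ph [simp]: "Ph (Ph x) = Ph x"
  unfolding Ph_def[of "Ph x"] by (simp add: w_ii_Ph) (simp add: Ph_def)

lemma Ph_dd: "k \<in> J \<Longrightarrow> Ph (dd k) = dd k"
  using finite_J by (simp add: Ph_def w_ii_dd if_distrib[of "\<lambda>c. c *\<^sub>R _"] cong: if_cong)

lemma PI_ii: "k \<in> J \<Longrightarrow> PI (ii k) = ii k"
  using finite_J by (simp add: PI_def w_ii_dd if_distrib[of "\<lambda>c. c *\<^sub>R _"] cong: if_cong)

lemma Ph_PI [simp]: "Ph (PI x) = 0"
  using finite_J by (simp add: Ph_def PI_def w_sum_right w_simps w_ii_ii)

lemma PI_Ph [simp]: "PI (Ph x) = 0"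
  using finite_J by (simp add: Ph_def PI_def w_sum_left w_simps w_dd_dd)

lemma w_PI_left: "\<omega> (PI x) y = \<omega> x (Ph y)"
  by (simp add: Ph_def PI_def w_sum_left w_sum_right w_simps mult.commute)

lemma w_PI_right: "\<omega> x (PI y) = \<omega> (Ph x) y"
  using w_PI_left[of y x] skew[of x "PI y"] skew[of y "Ph x"] by simp

lemma w_Ph_Ph [simp]: "\<omega> (Ph x) (Ph y) = 0"
  using w_PI_left[of "Ph x" y] by (simp add: w_simps)

lemma w_PB_left: "\<omega> (PB x) y = \<omega> x (PB y)"
  by (simp add: PB_def w_simps w_PI_left w_PI_right)

lemma PI_mem_ideal: "PI x \<in> ideal"
  unfolding ideal_def PI_def by (intro span_sum span_scale span_base) auto

lemma PI_ideal: "z \<in> ideal \<Longrightarrow> PI z = z"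
  unfolding ideal_def
  by (induction rule: span_induct_alt) (auto simp: proj_simps PI_ii)

lemma ideal_central: "z \<in> ideal \<Longrightarrow> z \<in> central_part"
  unfolding ideal_def
  using span_minimal[OF _ subspace_central_part, of "ii ` J"] ii_central by blast

lemma ideal_mult: "z \<in> ideal \<Longrightarrow> p x z \<in> ideal"
  unfolding ideal_def
  by (induction rule: span_induct_alt)
    (auto simp: p_simps span_zero intro: span_add span_scale ii_ideal)

lemma PI_PI [simp]: "PI (PI x) = PI x"
  by (rule PI_ideal[OF PI_mem_ideal])

lemma PB_Ph [simp]: "PB (Ph x) = 0" and PB_PI [simp]: "PB (PI x) = 0"
  and Ph_PB [simp]: "Ph (PB x) = 0" and PI_PB [simp]: "PI (PB x) = 0"
  by (simp_all add: PB_def proj_simps)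

lemma PB_PB [simp]: "PB (PB x) = PB x"
  by (subst (1) PB_def) simp

lemma decomp: "x = Ph x + PB x + PI x"
  by (simp add: PB_def)

lemma Ph_ideal: "z \<in> ideal \<Longrightarrow> Ph z = 0" and PB_ideal: "z \<in> ideal \<Longrightarrow> PB z = 0"
  using PI_ideal[of z] Ph_PI[of z] PB_PI[of z] by simp_all

lemma ideal_iff: "z \<in> ideal \<longleftrightarrow> Ph z = 0 \<and> PB z = 0"
  using Ph_ideal PB_ideal decomp[of z] PI_mem_ideal[of z] by auto

lemma w_ideal: "z \<in> ideal \<Longrightarrow> \<omega> z y = \<omega> z (Ph y)"
  using w_PI_left[of z y] PI_ideal[of z] by simp

lemma Ph_eq_0_iff: "Ph x = 0 \<longleftrightarrow> (\<forall>j\<in>J. \<omega> (ii j) x = 0)"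
  using w_ii_Ph[of _ x] by (auto simp: w_simps) (simp add: Ph_def)

lemma perp_ideal: "perp \<omega> ideal = {x. Ph x = 0}"
proof -
  have "x \<in> perp \<omega> ideal \<longleftrightarrow> Ph x = 0" for x
  proof
    assume "x \<in> perp \<omega> ideal"
    then have "\<omega> x (ii j) = 0" if "j \<in> J" for j
      using that by (simp add: perp_def ideal_def span_base)
    then show "Ph x = 0" using skew[of _ x] by (simp add: Ph_eq_0_iff)
  next
    assume "Ph x = 0"
    then have "\<omega> x z = 0" if "z \<in> ideal" for z
      using w_ideal[OF that, of x] skew[of x z] by (simp add: w_simps)
    then show "x \<in> perp \<omega> ideal" by (simp add: perp_def)
  qed
  then show ?thesis by blast
qed

lemma ideal_subset_perp: "ideal \<subseteq> perp \<omega> ideal"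
  by (auto simp: perp_ideal Ph_ideal)

lemma p_PI_left [simp]: "p (PI x) y = 0"
  by (rule central_part_mult_left[OF ideal_central[OF PI_mem_ideal]])

lemma Ph_p_PI [simp]: "Ph (p x (PI y)) = 0" and PB_p_PI [simp]: "PB (p x (PI y)) = 0"
  using ideal_mult[OF PI_mem_ideal, of x y] by (simp_all add: Ph_ideal PB_ideal)

lemma Ph_comm: "Ph (p x y) = Ph (p y x)"
  unfolding Ph_def by (intro sum.cong) (simp_all add: central_part_swap[OF ii_central, of _ x y])

lemma Ph_mult_right: "Ph y = 0 \<Longrightarrow> Ph (p x y) = 0"
proof -
  assume y: "Ph y = 0"
  have "\<omega> (ii j) (p x y) = 0" if "j \<in> J" for j
  proof -
    have "p x (ii j) \<in> ideal" using ii_ideal[OF that] by (simp add: ideal_def)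
    from w_ideal[OF this, of y] show ?thesis using y by (simp add: inv1 w_simps)
  qed
  then show ?thesis by (simp add: Ph_eq_0_iff)
qed

lemma Ph_mult_left: "Ph x = 0 \<Longrightarrow> Ph (p x y) = 0"
  using Ph_mult_right[of x y] by (simp add: Ph_comm[of x])

lemma Ph_mult_Ph_right: "Ph (p x (Ph y)) = Ph (p x y)"
  using Ph_mult_right[of "y - Ph y" x] by (simp add: proj_simps p_simps)

lemma Ph_mult_Ph_left: "Ph (p (Ph x) y) = Ph (p x y)"
  using Ph_mult_Ph_right[of y x] by (simp add: Ph_comm[of _ y])

lemma p_PB_left: "p (PB x) y = p x y - p (Ph x) y"
  by (simp add: PB_def p_simps)

lemma PB_p_PB: "PB (p x (PB y)) = PB (p x y) - PB (p x (Ph y))"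
  by (simp add: PB_def[of y] p_simps proj_simps)

lemma w_PB_right: "Ph z = 0 \<Longrightarrow> \<omega> z (PB w) = \<omega> z w - \<omega> z (Ph w)"
  by (simp add: PB_def[of w] w_simps w_PI_right)

lemma PB_eqI:
  assumes "PB z = z" "PB z' = z'" "\<And>x. PB x = x \<Longrightarrow> \<omega> x z = \<omega> x z'"
  shows "z = z'"
proof (rule form_eqI)
  fix y
  have "\<omega> y z = \<omega> y z'"
    using assms(3)[of "PB y"] assms(1,2) by (simp add: w_PB_left)
  then show "\<omega> z y = \<omega> z' y" using skew[of z y] skew[of z' y] by simp
qed

text \<open>
  \<open>Om\<close> is the datum \<open>\<Omega>\<close>, characterised in \<open>w_Om\<close>: a product \<open>p u a\<close> with \<open>u\<close> in \<open>\<B>\<close> has a component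
  in the ideal, which is a functional of \<open>b\<close> in \<open>\<h>\<close> and linear in \<open>u\<close>.  \<open>Radj a\<close> is the adjoint of
  right multiplication by \<open>a\<close>.
\<close>
definition Om :: "'a \<Rightarrow> 'a \<Rightarrow> 'a" where
  "Om a b = PB (SOME x. \<forall>y. \<omega> x y = \<omega> (p (PB y) a) b)"

definition Radj :: "'a \<Rightarrow> 'a \<Rightarrow> 'a" where
  "Radj a y = (SOME z. \<forall>x. \<omega> x z = \<omega> (p x a) y)"

lemma w_Om: "\<omega> (Om a b) y = \<omega> (p (PB y) a) b"
proof -
  have "linear (\<lambda>y. \<omega> (p (PB y) a) b)"
    by (intro linearI) (simp_all add: proj_simps p_simps w_simps)
  from functional_represented_by_form[OF fd w_lin1 w_lin2 nondeg this]
  have "\<exists>x. \<forall>y. \<omega> x y = \<omega> (p (PB y) a) b" by blast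
  from someI_ex[OF this] show ?thesis by (simp add: Om_def w_PB_left)
qed

lemma PB_Om [simp]: "PB (Om a b) = Om a b"
  by (simp add: Om_def)

lemma Om_lin1: "linear (\<lambda>a. Om a b)" and Om_lin2: "linear (Om a)"
  by (intro linearI form_eqI; simp add: w_Om w_simps p_simps)+

lemma Om_skew: "Om a b = - Om b a"
  by (rule form_eqI) (simp add: w_Om w_simps inv1 skew[of a])

lemma w_Radj: "\<omega> x (Radj a y) = \<omega> (p x a) y"
proof -
  have "linear (\<lambda>x. - \<omega> (p x a) y)"
    by (intro linearI) (simp_all add: p_simps w_simps)
  from functional_represented_by_form[OF fd w_lin1 w_lin2 nondeg this]
  obtain z where "\<And>x. \<omega> z x = - \<omega> (p x a) y" by blast
  then have "\<forall>x. \<omega> x z = \<omega> (p x a) y" using skew[of _ z] by simp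
  then have "\<exists>z. \<forall>x. \<omega> x z = \<omega> (p x a) y" by blast
  from someI_ex[OF this] show ?thesis by (simp add: Radj_def)
qed

lemma w_PB_Radj: "PB x = x \<Longrightarrow> \<omega> x (PB (Radj a y)) = \<omega> (p x a) y"
  using w_Radj[of x a y] w_PB_left[of x "Radj a y"] by simp

text \<open>
  The conditions on the data of a double extension, for arguments in the respective components.  Each is
  a component of one of the laws \<open>left_mult_commute\<close> and \<open>left_mult_swap\<close>; inner
  projections may be dropped because the ideal acts by zero from the left and absorbs products from the
  right.  These are the conditions A1 to A10 in their order.
\<close>
lemma data_conditions_A:
  assumes a: "Ph a = a" and b: "Ph b = b" and c: "Ph c = c" and u: "PB u = u" and v: "PB v = v"
  shows "PB (p (PB (p u v) - PB (p v u)) a) = 0"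
    and "PB (p u (PB (p v a))) = PB (p v (PB (p u a)))"
    and "PB (p (PB (p u a)) v) = PB (p (PB (p a u)) v)"
    and "PB (p a (PB (p u v))) = PB (p u (PB (p a v)))"
    and "PB (p (PB (p u a)) b) = PB (p (PB (p a u)) b)"
    and "PB (p a (PB (p b u))) = PB (p b (PB (p a u)))"
    and "PB (p a (PB (p u b))) = PB (p u (Ph (p a b))) + PB (p u (PB (p a b)))"
    and "PB (p (PB (p a b)) u) = PB (p (PB (p b a)) u)"
    and "PB (p (PB (p a b)) c) = PB (p (PB (p b a)) c)"
    and "PB (p a (Ph (p b c))) - PB (p b (Ph (p a c))) = PB (p b (PB (p a c))) - PB (p a (PB (p b c)))"
proof -
  have [simp]: "Ph u = 0" "Ph v = 0" using u v by (metis Ph_PB)+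
  note s = p_simps proj_simps p_PB_left PB_p_PB Ph_mult_left Ph_mult_right
  show "PB (p (PB (p u v) - PB (p v u)) a) = 0"
    by (simp add: s left_mult_swap[of u])
  show "PB (p u (PB (p v a))) = PB (p v (PB (p u a)))"
    by (simp add: s left_mult_commute[of u])
  show "PB (p (PB (p u a)) v) = PB (p (PB (p a u)) v)"
    by (simp add: s left_mult_swap[of u])
  show "PB (p a (PB (p u v))) = PB (p u (PB (p a v)))"
    by (simp add: s left_mult_commute[of u])
  show "PB (p (PB (p u a)) b) = PB (p (PB (p a u)) b)"
    by (simp add: s left_mult_swap[of u])
  show "PB (p a (PB (p b u))) = PB (p b (PB (p a u)))"
    by (simp add: s left_mult_commute[of a])
  show "PB (p a (PB (p u b))) = PB (p u (Ph (p a b))) + PB (p u (PB (p a b)))"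
    by (simp add: s left_mult_commute[of a])
  show "PB (p (PB (p a b)) u) = PB (p (PB (p b a)) u)"
    by (simp add: s left_mult_swap[of a] Ph_comm[of a])
  show "PB (p (PB (p a b)) c) = PB (p (PB (p b a)) c)"
    by (simp add: s left_mult_swap[of a] Ph_comm[of a])
  show "PB (p a (Ph (p b c))) - PB (p b (Ph (p a c))) = PB (p b (PB (p a c))) - PB (p a (PB (p b c)))"
    by (simp add: s left_mult_commute[of a])
qed

text \<open>
  The conditions B1, B2, B3, B5 and B6.  Those on adjoints are tested against an arbitrary element of
  \<open>\<B>\<close>, where adjoints disappear.
\<close>
lemma data_conditions_B:
  assumes a: "Ph a = a" and b: "Ph b = b" and c: "Ph c = c" and l: "Ph l = l"
    and u: "PB u = u" and v: "PB v = v"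
  shows "PB (Radj a (PB (p u b))) = - PB (Radj b (PB (p u a)))"
    and "PB (Radj a (Om b c)) = PB (p a (Om b c))"
    and "PB (Radj b (PB (p a c))) + Om (Ph (p a c)) b = - PB (Radj c (PB (p a b))) - Om (Ph (p a b)) c"
    and "\<omega> (Om a b) (PB (p u v) - PB (p v u)) = 0"
    and "\<omega> (Om c l) (PB (p a b) - PB (p b a)) = 0"
proof -
  have [simp]: "Ph u = 0" "Ph v = 0" using u v by (metis Ph_PB)+
  note s = p_simps proj_simps w_simps p_PB_left Ph_mult_left Ph_mult_right w_PB_right w_PB_Radj
  show "PB (Radj a (PB (p u b))) = - PB (Radj b (PB (p u a)))"
  proof (rule PB_eqI)
    fix x assume x: "PB x = x"
    then have [simp]: "Ph x = 0" by (metis Ph_PB)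
    have "\<omega> (p x a) (p u b) = - \<omega> (p x b) (p u a)"
      using skew[of "p x b" "p u a"] by (simp add: inv1 left_mult_commute[of x])
    moreover have "\<omega> x (PB (Radj d (PB z))) = \<omega> (p x d) z" if "Ph z = 0" for z d
      using that by (simp add: w_PB_Radj[OF x] w_PB_right Ph_mult_left w_simps)
    ultimately show "\<omega> x (PB (Radj a (PB (p u b)))) = \<omega> x (- PB (Radj b (PB (p u a))))"
      by (simp add: Ph_mult_left w_simps)
  qed (simp_all add: proj_simps)
  show "PB (Radj a (Om b c)) = PB (p a (Om b c))"
  proof (rule PB_eqI)
    fix x assume x: "PB x = x"
    then have [simp]: "Ph x = 0" by (metis Ph_PB)
    have "\<omega> x (PB (Radj a (Om b c))) = - \<omega> (Om b c) (p x a)"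
      using x skew[of "p x a" "Om b c"] by (simp add: w_PB_Radj)
    also have "\<dots> = - \<omega> (Om b c) (p a x)"
      by (simp add: w_Om s left_mult_swap[of x])
    also have "\<dots> = \<omega> x (PB (p a (Om b c)))"
      using skew[of "p a x" "Om b c"] x by (simp add: w_PB_left[symmetric] inv1)
    finally show "\<omega> x (PB (Radj a (Om b c))) = \<omega> x (PB (p a (Om b c)))" .
  qed simp_all
  show "PB (Radj b (PB (p a c))) + Om (Ph (p a c)) b = - PB (Radj c (PB (p a b))) - Om (Ph (p a b)) c"
  proof (rule PB_eqI)
    fix x assume x: "PB x = x"
    then have [simp]: "Ph x = 0" by (metis Ph_PB)
    have Om: "\<omega> x (Om (Ph z) d) = \<omega> (p x d) (Ph z)" for z d
      using x skew[of x "Om (Ph z) d"] skew[of d "p x (Ph z)"] by (simp add: w_Om inv1)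
    have *: "\<omega> x (PB (Radj d (PB z)) + Om (Ph z) d) = \<omega> (p x d) z" for z d
      unfolding linear_add[OF w_lin2] Om w_PB_Radj[OF x]
      by (simp add: w_PB_right Ph_mult_left)
    have "\<omega> (p x b) (p a c) = - \<omega> (p x c) (p a b)"
      using skew[of "p x c" "p a b"] by (simp add: inv1 left_mult_commute[of x])
    then show "\<omega> x (PB (Radj b (PB (p a c))) + Om (Ph (p a c)) b)
        = \<omega> x (- PB (Radj c (PB (p a b))) - Om (Ph (p a b)) c)"
      using *[of b "p a c"] *[of c "p a b"] by (simp add: w_simps)
  qed (simp_all add: proj_simps)
  show "\<omega> (Om a b) (PB (p u v) - PB (p v u)) = 0"
    by (simp add: w_simps w_Om s left_mult_swap[of u])
  show "\<omega> (Om c l) (PB (p a b) - PB (p b a)) = 0"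
    by (simp add: w_simps w_Om s left_mult_swap[of a] Ph_comm[of a])
qed

end

section \<open>The double extension attached to a frame\<close>

text \<open>
  \<open>B\<close> and \<open>H\<close> are any structures that \<open>sB\<close> and \<open>sH\<close> identify with the components \<open>\<B>\<close> and \<open>\<h>\<close>, with
  the products projected to them; the quotients of the algebra are of this kind.
\<close>
locale frame_model =
  balanced_frame p \<omega> J dd ii +
  B: concrete_space B sB "{u. darboux_frame.PB \<omega> J dd ii u = u}" +
  H: concrete_space H sH "{a. darboux_frame.Ph \<omega> J dd ii a = a}"
  for p :: "'a::real_vector \<Rightarrow> 'a \<Rightarrow> 'a" and \<omega> :: "'a \<Rightarrow> 'a \<Rightarrow> real"
    and J :: "nat set" and dd ii :: "nat \<Rightarrow> 'a"
    and B :: "(real, 'b) module" and sB :: "'b \<Rightarrow> 'a"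
    and H :: "(real, 'h) module" and sH :: "'h \<Rightarrow> 'a" +
  fixes \<omega>B :: "'b \<Rightarrow> 'b \<Rightarrow> real"
  assumes B_mult_closed: "\<And>X Y. X \<in> carrier B \<Longrightarrow> Y \<in> carrier B \<Longrightarrow> X \<otimes>\<^bsub>B\<^esub> Y \<in> carrier B"
    and sB_mult: "\<And>X Y. X \<in> carrier B \<Longrightarrow> Y \<in> carrier B \<Longrightarrow> sB (X \<otimes>\<^bsub>B\<^esub> Y) = PB (p (sB X) (sB Y))"
    and H_mult_closed: "\<And>X Y. X \<in> carrier H \<Longrightarrow> Y \<in> carrier H \<Longrightarrow> X \<otimes>\<^bsub>H\<^esub> Y \<in> carrier H"
    and sH_mult: "\<And>X Y. X \<in> carrier H \<Longrightarrow> Y \<in> carrier H \<Longrightarrow> sH (X \<otimes>\<^bsub>H\<^esub> Y) = Ph (p (sH X) (sH Y))"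
    and form_B: "\<And>X Y. X \<in> carrier B \<Longrightarrow> Y \<in> carrier B \<Longrightarrow> \<omega>B X Y = \<omega> (sB X) (sB Y)"
begin

definition F :: "'h \<Rightarrow> 'b \<Rightarrow> 'b" where "F X U = B.r (PB (p (sH X) (sB U)))"
definition G :: "'h \<Rightarrow> 'b \<Rightarrow> 'b" where "G X U = B.r (PB (p (sB U) (sH X)))"
definition \<theta> :: "'h \<Rightarrow> 'h \<Rightarrow> 'b" where "\<theta> X Y = B.r (PB (p (sH X) (sH Y)))"
definition \<Omega> :: "'h \<Rightarrow> 'h \<Rightarrow> 'b" where "\<Omega> X Y = B.r (Om (sH X) (sH Y))"
definition L :: "'h \<Rightarrow> 'h \<Rightarrow> 'h \<Rightarrow> real" where
  "L X Y = (\<lambda>Z\<in>carrier H. \<omega> (p (sH X) (sH Y)) (sH Z))"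

lemma sB_proj: "U \<in> carrier B \<Longrightarrow> PB (sB U) = sB U" "U \<in> carrier B \<Longrightarrow> Ph (sB U) = 0"
    "U \<in> carrier B \<Longrightarrow> PI (sB U) = 0"
  and sH_proj: "X \<in> carrier H \<Longrightarrow> Ph (sH X) = sH X" "X \<in> carrier H \<Longrightarrow> PB (sH X) = 0"
    "X \<in> carrier H \<Longrightarrow> PI (sH X) = 0"
  using B.s_mem[of U] H.s_mem[of X] PB_Ph[of "sH X"] PI_Ph[of "sH X"] Ph_PB[of "sB U"] PI_PB[of "sB U"]
  by auto

lemma rB: "PB x = x \<Longrightarrow> B.r x \<in> carrier B" "PB x = x \<Longrightarrow> sB (B.r x) = x"
  and rH: "Ph x = x \<Longrightarrow> H.r x \<in> carrier H" "Ph x = x \<Longrightarrow> sH (H.r x) = x"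
  by (simp_all add: B.r_closed B.s_r H.r_closed H.s_r)

lemma data_closed: "F X U \<in> carrier B" "G X U \<in> carrier B" "\<theta> X Y \<in> carrier B" "\<Omega> X Y \<in> carrier B"
  and sB_data: "sB (F X U) = PB (p (sH X) (sB U))" "sB (G X U) = PB (p (sB U) (sH X))"
    "sB (\<theta> X Y) = PB (p (sH X) (sH Y))" "sB (\<Omega> X Y) = Om (sH X) (sH Y)"
  by (simp_all add: F_def G_def \<theta>_def \<Omega>_def rB)

lemmas B_simps = B.s_simps B_mult_closed sB_mult data_closed sB_data
lemmas H_simps = H.s_simps H_mult_closed sH_mult

lemma adjoint_eq:
  assumes "Y \<in> carrier B"
  shows "adjoint_wrt B \<omega>B (G X) Y = B.r (PB (Radj (sH X) (sB Y)))"
  unfolding adjoint_wrt_def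
proof (rule the_equality)
  have adj: "\<omega>B (G X U) Y = \<omega> (sB U) (PB (Radj (sH X) (sB Y)))" if "U \<in> carrier B" for U
    using that assms by (simp add: form_B B_simps w_PB_left w_PB_Radj sB_proj)
  then show "B.r (PB (Radj (sH X) (sB Y))) \<in> carrier B \<and>
      (\<forall>U\<in>carrier B. \<omega>B (G X U) Y = \<omega>B U (B.r (PB (Radj (sH X) (sB Y)))))"
    by (simp add: rB form_B)
  fix Z assume Z: "Z \<in> carrier B \<and> (\<forall>U\<in>carrier B. \<omega>B (G X U) Y = \<omega>B U Z)"
  have "sB Z = PB (Radj (sH X) (sB Y))"
  proof (rule PB_eqI)
    fix x assume "PB x = x"
    then show "\<omega> x (sB Z) = \<omega> x (PB (Radj (sH X) (sB Y)))"
      using Z adj[of "B.r x"] by (auto simp: rB form_B)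
  qed (use Z sB_proj in auto)
  then show "Z = B.r (PB (Radj (sH X) (sB Y)))"
    using Z by (intro B.s_eqI) (simp_all add: rB)
qed

lemma bilinear_B: "bilinear_map B B B (\<otimes>\<^bsub>B\<^esub>)"
  by (rule bilinear_mapI[OF B.concrete_space_axioms B.concrete_space_axioms B.concrete_space_axioms,
        where g = "\<lambda>x y. PB (p x y)"])
    (auto intro!: linearI simp: p_simps proj_simps B_simps)

lemma bilinear_H: "bilinear_map H H H (\<otimes>\<^bsub>H\<^esub>)"
  by (rule bilinear_mapI[OF H.concrete_space_axioms H.concrete_space_axioms H.concrete_space_axioms,
        where g = "\<lambda>x y. Ph (p x y)"])
    (auto intro!: linearI simp: p_simps proj_simps H_simps)

lemma pre_symplectic_B: "pre_symplectic_lsa B \<omega>B"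
proof (rule pre_symplectic_lsa.intro)
  show "fin_dim_space B" by (rule B.fin_dim_space[OF fd])
  show "bilinear_map B B B (\<otimes>\<^bsub>B\<^esub>)" by (rule bilinear_B)
  show "bilinear_map B B real_line \<omega>B"
    by (rule bilinear_mapI[OF B.concrete_space_axioms B.concrete_space_axioms
          concrete_space_type_algebra w_lin2 w_lin1])
      (auto simp: form_B type_algebra_def)
next
  fix U V W assume c: "U \<in> carrier B" "V \<in> carrier B" "W \<in> carrier B"
  show "(U \<otimes>\<^bsub>B\<^esub> V) \<otimes>\<^bsub>B\<^esub> W \<ominus>\<^bsub>B\<^esub> U \<otimes>\<^bsub>B\<^esub> (V \<otimes>\<^bsub>B\<^esub> W) =
      (V \<otimes>\<^bsub>B\<^esub> U) \<otimes>\<^bsub>B\<^esub> W \<ominus>\<^bsub>B\<^esub> V \<otimes>\<^bsub>B\<^esub> (U \<otimes>\<^bsub>B\<^esub> W)"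
    by (rule B.s_eqI) (simp_all add: c B_simps p_PB_left PB_p_PB sB_proj Ph_mult_left p_simps proj_simps
        left_mult_swap[of "sB U"] left_mult_commute[of "sB U"])
  show "\<omega>B (U \<otimes>\<^bsub>B\<^esub> V) W = \<omega>B V (U \<otimes>\<^bsub>B\<^esub> W)"
    by (simp add: c form_B B_simps w_PB_left sB_proj inv1 w_PB_right Ph_mult_left w_simps)
next
  fix U V assume "U \<in> carrier B" "V \<in> carrier B"
  then show "\<omega>B U V = - \<omega>B V U" by (simp add: form_B skew[of "sB U"])
next
  fix U assume U: "U \<in> carrier B" and z: "\<And>V. V \<in> carrier B \<Longrightarrow> \<omega>B U V = 0"
  have "sB U = 0"
  proof (rule PB_eqI)
    fix x assume "PB x = x"
    then show "\<omega> x (sB U) = \<omega> x 0"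
      using z[of "B.r x"] U skew[of x "sB U"] by (simp add: rB form_B w_simps)
  qed (use U in \<open>simp_all add: sB_proj proj_simps\<close>)
  then show "U = \<zero>\<^bsub>B\<^esub>" using U by (intro B.s_eqI) (simp_all add: B_simps)
qed

lemma comm_assoc_H: "comm_assoc_algebra H"
proof (rule comm_assoc_algebra.intro)
  show "fin_dim_space H" by (rule H.fin_dim_space[OF fd])
  show "bilinear_map H H H (\<otimes>\<^bsub>H\<^esub>)" by (rule bilinear_H)
next
  fix X Y assume "X \<in> carrier H" "Y \<in> carrier H"
  then show "X \<otimes>\<^bsub>H\<^esub> Y = Y \<otimes>\<^bsub>H\<^esub> X"
    by (intro H.s_eqI) (simp_all add: H_simps Ph_comm[of "sH X"])
next
  fix X Y Z assume c: "X \<in> carrier H" "Y \<in> carrier H" "Z \<in> carrier H"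
  have "Ph (p (p x y) z) = Ph (p x (p y z))" for x y z
  proof -
    have "Ph (p (p x y) z) = Ph (p x (p z y))"
      by (simp add: Ph_comm[of _ z] left_mult_commute[of z])
    then show ?thesis by (metis Ph_comm Ph_mult_Ph_right)
  qed
  then show "(X \<otimes>\<^bsub>H\<^esub> Y) \<otimes>\<^bsub>H\<^esub> Z = X \<otimes>\<^bsub>H\<^esub> (Y \<otimes>\<^bsub>H\<^esub> Z)"
    by (intro H.s_eqI) (simp_all add: c H_simps Ph_mult_Ph_left Ph_mult_Ph_right)
qed

lemma functional_in_dual: "(\<lambda>Z\<in>carrier H. \<omega> x (sH Z)) \<in> carrier (dual_space H)"
  by (auto simp: dual_space_def LinearCombinations.module_hom_def type_algebra_def H_simps w_simps)

lemma bilinear_L: "bilinear_map H H (dual_space H) L"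
  unfolding bilinear_map_def LinearCombinations.module_hom_def
  using functional_in_dual
  by (auto simp: L_def H_simps p_simps w_simps dual_space_def fun_eq_iff restrict_def)

theorem double_extension_data: "double_extension_data B \<omega>B H F G \<theta> L \<Omega>"
proof (intro double_extension_data.intro pre_symplectic_B comm_assoc_H double_extension_data_axioms.intro)
  note conc = H.concrete_space_axioms B.concrete_space_axioms
  show "bilinear_map H B B F"
    by (rule bilinear_mapI[OF conc(1,2,2), where g = "\<lambda>x y. PB (p x y)"])
      (auto intro!: linearI simp: p_simps proj_simps B_simps)
  show "bilinear_map H B B G"
    by (rule bilinear_mapI[OF conc(1,2,2), where g = "\<lambda>x y. PB (p y x)"])
      (auto intro!: linearI simp: p_simps proj_simps B_simps)
  show "bilinear_map H H B \<theta>"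
    by (rule bilinear_mapI[OF conc(1,1,2), where g = "\<lambda>x y. PB (p x y)"])
      (auto intro!: linearI simp: p_simps proj_simps B_simps)
  show "bilinear_map H H B \<Omega>"
    by (rule bilinear_mapI[OF conc(1,1,2) Om_lin2 Om_lin1]) (auto simp: B_simps)
  show "bilinear_map H H (dual_space H) L" by (rule bilinear_L)
next
  fix a u v assume c: "a \<in> carrier H" "u \<in> carrier B" "v \<in> carrier B"
  then show "\<omega>B (F a u) v = \<omega>B u (F a v)"
    by (simp add: form_B B_simps w_PB_left sB_proj inv1 w_PB_right Ph_mult_right w_simps)
  note A = data_conditions_A[of "sH a" "sH a" "sH a" "sB u" "sB v"]
  show "G a (commutator B u v) = \<zero>\<^bsub>B\<^esub>"
    by (rule B.s_eqI) (simp_all add: c commutator_def B_simps A(1) sB_proj sH_proj)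
  show "u \<otimes>\<^bsub>B\<^esub> G a v = v \<otimes>\<^bsub>B\<^esub> G a u"
    by (rule B.s_eqI) (simp_all add: c B_simps A(2) sB_proj sH_proj)
  show "G a u \<otimes>\<^bsub>B\<^esub> v = F a u \<otimes>\<^bsub>B\<^esub> v"
    by (rule B.s_eqI) (simp_all add: c B_simps A(3) sB_proj sH_proj)
  show "F a (u \<otimes>\<^bsub>B\<^esub> v) = u \<otimes>\<^bsub>B\<^esub> F a v"
    by (rule B.s_eqI) (simp_all add: c B_simps A(4) sB_proj sH_proj)
next
  fix a b u assume c: "a \<in> carrier H" "b \<in> carrier H" "u \<in> carrier B"
  note A = data_conditions_A[of "sH a" "sH b" "sH a" "sB u" "sB u"]
  note B = data_conditions_B[of "sH a" "sH b" "sH a" "sH a" "sB u" "sB u"]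
  show "G b (G a u) = G b (F a u)"
    by (rule B.s_eqI) (simp_all add: c B_simps A(5) sB_proj sH_proj)
  show "F a (F b u) = F b (F a u)"
    by (rule B.s_eqI) (simp_all add: c B_simps A(6) sB_proj sH_proj)
  show "F a (G b u) = G (a \<otimes>\<^bsub>H\<^esub> b) u \<oplus>\<^bsub>B\<^esub> u \<otimes>\<^bsub>B\<^esub> \<theta> a b"
    by (rule B.s_eqI) (simp_all add: c B_simps H_simps A(7) sB_proj sH_proj)
  show "\<theta> a b \<otimes>\<^bsub>B\<^esub> u = \<theta> b a \<otimes>\<^bsub>B\<^esub> u"
    by (rule B.s_eqI) (simp_all add: c B_simps A(8) sB_proj sH_proj)
  show "adjoint_wrt B \<omega>B (G a) (G b u) = \<ominus>\<^bsub>B\<^esub> adjoint_wrt B \<omega>B (G b) (G a u)"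
    by (rule B.s_eqI) (simp_all add: c B_simps adjoint_eq rB B(1) proj_simps sB_proj sH_proj)
next
  fix a b c assume h: "a \<in> carrier H" "b \<in> carrier H" "c \<in> carrier H"
  note A = data_conditions_A[of "sH a" "sH b" "sH c" 0 0]
  note B = data_conditions_B[of "sH a" "sH b" "sH c" "sH a" 0 0]
  show "L a b c = - L a c b"
    using h skew[of "sH b" "p (sH a) (sH c)"] by (simp add: L_def inv1)
  show "G c (\<theta> a b) = G c (\<theta> b a)"
    by (rule B.s_eqI) (simp_all add: h B_simps A(9) proj_simps sH_proj)
  show "\<theta> a (b \<otimes>\<^bsub>H\<^esub> c) \<ominus>\<^bsub>B\<^esub> \<theta> b (a \<otimes>\<^bsub>H\<^esub> c) = F b (\<theta> a c) \<ominus>\<^bsub>B\<^esub> F a (\<theta> b c)"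
    by (rule B.s_eqI) (simp_all add: h B_simps H_simps A(10) proj_simps sH_proj)
  show "adjoint_wrt B \<omega>B (G a) (\<Omega> b c) = F a (\<Omega> b c)"
    by (rule B.s_eqI) (simp_all add: h B_simps adjoint_eq rB B(2) proj_simps sH_proj)
  show "adjoint_wrt B \<omega>B (G b) (\<theta> a c) \<oplus>\<^bsub>B\<^esub> \<Omega> (a \<otimes>\<^bsub>H\<^esub> c) b =
      (\<ominus>\<^bsub>B\<^esub> adjoint_wrt B \<omega>B (G c) (\<theta> a b)) \<ominus>\<^bsub>B\<^esub> \<Omega> (a \<otimes>\<^bsub>H\<^esub> b) c"
    by (rule B.s_eqI) (simp_all add: h B_simps H_simps adjoint_eq rB B(3) proj_simps sH_proj)
next
  fix a b assume h: "a \<in> carrier H" "b \<in> carrier H"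
  show "\<Omega> a b = \<ominus>\<^bsub>B\<^esub> \<Omega> b a"
    by (rule B.s_eqI) (simp_all add: h B_simps Om_skew[of "sH a"])
  fix u v assume c: "u \<in> carrier B" "v \<in> carrier B"
  show "\<omega>B (\<Omega> a b) (commutator B u v) = 0"
    using data_conditions_B(4)[of "sH a" "sH b" "sH a" "sH a" "sB u" "sB v"] h c
    by (simp add: commutator_def form_B B_simps sB_proj sH_proj)
next
  fix a b c l assume h: "a \<in> carrier H" "b \<in> carrier H" "c \<in> carrier H" "l \<in> carrier H"
  show "L a (b \<otimes>\<^bsub>H\<^esub> c) l - L b (a \<otimes>\<^bsub>H\<^esub> c) l = - L a (b \<otimes>\<^bsub>H\<^esub> l) c + L b (a \<otimes>\<^bsub>H\<^esub> l) c"
    using h cocycle[of "sH a" "sH b" "sH c" "sH l"] by (simp add: L_def H_simps sH_proj)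
  show "\<omega>B (\<Omega> c l) (\<theta> a b \<ominus>\<^bsub>B\<^esub> \<theta> b a) = 0"
    using data_conditions_B(5)[of "sH a" "sH b" "sH c" "sH l" 0 0] h
    by (simp add: form_B B_simps proj_simps sH_proj)
qed

text \<open>
  The component in the ideal is recorded as a functional: on \<open>\<h>\<close>, which is isotropic and orthogonal to
  \<open>\<B>\<close>, the functional \<open>\<omega> x\<close> only sees \<open>PI x\<close>.
\<close>
definition \<phi> :: "'a \<Rightarrow> 'h \<times> 'b \<times> ('h \<Rightarrow> real)" where
  "\<phi> x = (H.r (Ph x), B.r (PB x), \<lambda>Z\<in>carrier H. \<omega> x (sH Z))"

abbreviation E :: "(real, 'h \<times> 'b \<times> ('h \<Rightarrow> real)) module" where
  "E \<equiv> dext_algebra B \<omega>B H F G \<theta> L \<Omega>"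

lemma carrier_E: "carrier E = carrier H \<times> carrier B \<times> carrier (dual_space H)"
  by (simp add: dext_algebra_def direct_sum_def)

lemma \<phi>_closed: "\<phi> x \<in> carrier E"
  using functional_in_dual by (simp add: carrier_E \<phi>_def rH rB)

lemma \<phi>_linear: "\<phi> \<in> linear_maps (type_algebra p) E"
proof -
  have "H.r (Ph (x + y)) = H.r (Ph x) \<oplus>\<^bsub>H\<^esub> H.r (Ph y)"
    "B.r (PB (x + y)) = B.r (PB x) \<oplus>\<^bsub>B\<^esub> B.r (PB y)"
    "H.r (Ph (c *\<^sub>R x)) = c \<odot>\<^bsub>H\<^esub> H.r (Ph x)"
    "B.r (PB (c *\<^sub>R x)) = c \<odot>\<^bsub>B\<^esub> B.r (PB x)" for x y c
    by (rule H.s_eqI B.s_eqI; simp add: rH rB H_simps B_simps proj_simps)+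
  then show ?thesis
    unfolding LinearCombinations.module_hom_def
    using \<phi>_closed
    by (auto simp: \<phi>_def dext_algebra_def direct_sum_def type_algebra_def dual_space_def w_simps
        restrict_def fun_eq_iff)
qed

lemma \<phi>_bij: "bij_betw \<phi> UNIV (carrier E)"
proof (rule bij_betwI')
  fix x y
  show "\<phi> x = \<phi> y \<longleftrightarrow> x = y"
  proof
    assume e: "\<phi> x = \<phi> y"
    then have "sH (H.r (Ph x)) = sH (H.r (Ph y))" "sB (B.r (PB x)) = sB (B.r (PB y))"
      by (simp_all add: \<phi>_def)
    then have 1: "Ph x = Ph y" "PB x = PB y" by (simp_all add: rH rB)
    have "(\<lambda>Z\<in>carrier H. \<omega> x (sH Z)) = (\<lambda>Z\<in>carrier H. \<omega> y (sH Z))"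
      using e by (simp add: \<phi>_def)
    from fun_cong[OF this] have "\<omega> x (dd j) = \<omega> y (dd j)" if "j \<in> J" for j
      using that rH[OF Ph_dd[OF that]] by (metis restrict_apply')
    then have "PI x = PI y" by (simp add: PI_def)
    with 1 show "x = y" using decomp by metis
  qed simp
next
  fix z assume z: "z \<in> carrier E"
  then obtain X U f where f: "z = (X, U, f)" "X \<in> carrier H" "U \<in> carrier B" "f \<in> carrier (dual_space H)"
    by (auto simp: carrier_E)
  have "linear (\<lambda>y. f (H.r (Ph y)))"
  proof -
    have "H.r (Ph (x + y)) = H.r (Ph x) \<oplus>\<^bsub>H\<^esub> H.r (Ph y)"
      "H.r (Ph (c *\<^sub>R x)) = c \<odot>\<^bsub>H\<^esub> H.r (Ph x)" for x y c
      by (rule H.s_eqI; simp add: rH H_simps proj_simps)+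
    then show ?thesis
      using f(4) by (intro linearI)
        (simp_all add: dual_space_def LinearCombinations.module_hom_def type_algebra_def rH)
  qed
  from functional_represented_by_form[OF fd w_lin1 w_lin2 nondeg this]
  obtain y where y: "\<And>x. \<omega> y x = f (H.r (Ph x))" by blast
  define x where "x = sH X + sB U + PI y"
  have "Ph x = sH X" "PB x = sB U"
    using f by (simp_all add: x_def proj_simps sH_proj sB_proj)
  moreover have "\<omega> x (sH Z) = f Z" if "Z \<in> carrier H" for Z
  proof -
    have "\<omega> (sH X) (sH Z) = 0" "\<omega> (sB U) (sH Z) = 0"
      using w_Ph_Ph[of "sH X" "sH Z"] w_PB_left[of "sB U" "sH Z"] f that
      by (simp_all add: sH_proj sB_proj w_simps)
    then show ?thesis
      using that by (simp add: x_def w_simps w_PI_left y sH_proj H.r_s)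
  qed
  moreover have "f \<in> extensional (carrier H)" using f(4) by (simp add: dual_space_def)
  ultimately have "\<phi> x = z"
    using f by (auto simp: \<phi>_def H.r_s B.r_s fun_eq_iff extensional_def)
  then show "\<exists>x\<in>UNIV. z = \<phi> x" by blast
qed (rule \<phi>_closed)

text \<open>
  Only the functional needs an argument.  Paired with \<open>c\<close> in \<open>\<h>\<close>, the product gives
  \<open>\<omega> y (p x c)\<close>; splitting \<open>y\<close> into three components and \<open>x\<close> into \<open>Ph x\<close> and \<open>PB x\<close> produces the terms
  of \<^const>\<open>dext_algebra\<close>.
\<close>
lemma \<phi>_mult: "\<phi> (p x y) = \<phi> x \<otimes>\<^bsub>E\<^esub> \<phi> y"
proof -
  have 1: "H.r (Ph (p x y)) = H.r (Ph x) \<otimes>\<^bsub>H\<^esub> H.r (Ph y)"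
    by (rule H.s_eqI) (simp_all add: rH H_simps Ph_mult_Ph_left Ph_mult_Ph_right)
  have 2: "B.r (PB (p x y)) = (B.r (PB x) \<otimes>\<^bsub>B\<^esub> B.r (PB y)) \<oplus>\<^bsub>B\<^esub> G (H.r (Ph y)) (B.r (PB x))
      \<oplus>\<^bsub>B\<^esub> F (H.r (Ph x)) (B.r (PB y)) \<oplus>\<^bsub>B\<^esub> \<theta> (H.r (Ph x)) (H.r (Ph y))"
    by (rule B.s_eqI) (simp_all add: rB rH B_simps PB_p_PB p_PB_left proj_simps)
  have 3: "\<omega> (p x y) (sH Z) = - \<omega>B (G Z (B.r (PB x))) (B.r (PB y)) + \<omega>B (\<Omega> (H.r (Ph y)) Z) (B.r (PB x))
      - \<omega>B (\<theta> (H.r (Ph x)) Z) (B.r (PB y)) + L (H.r (Ph x)) (H.r (Ph y)) Z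
      + (\<lambda>Z\<in>carrier H. \<omega> y (sH Z)) (H.r (Ph x) \<otimes>\<^bsub>H\<^esub> Z)" if Z: "Z \<in> carrier H" for Z
  proof -
    define c where "c = sH Z"
    define P where "P = p (PB x) c"
    define Q where "Q = p (Ph x) c"
    have PhP: "Ph P = 0" by (simp add: P_def Ph_mult_left)
    have "\<omega> (p x y) c = \<omega> y (P + Q)"
      unfolding inv1 P_def Q_def by (simp add: p_PB_left)
    also have "\<dots> = \<omega> (Ph y) P + \<omega> (PB y) P + \<omega> (PI y) P + \<omega> (Ph y) Q + \<omega> (PB y) Q + \<omega> (PI y) Q"
      by (subst (1) decomp[of y]) (simp add: w_simps)
    also have "\<omega> (PI y) P = 0" by (simp add: w_PI_left PhP w_simps)
    also have "\<omega> (PI y) Q = \<omega> y (Ph Q)" by (rule w_PI_left)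
    also have "\<omega> (PB y) P = - \<omega> (PB P) (PB y)"
      using skew[of "PB y" P] w_PB_left[of P "PB y"] by simp
    also have "\<omega> (PB y) Q = - \<omega> (PB Q) (PB y)"
      using skew[of "PB y" Q] w_PB_left[of Q "PB y"] by simp
    also have "\<omega> (Ph y) P = \<omega> (Om (Ph y) c) (PB x)"
      by (simp add: w_Om P_def inv1)
    also have "\<omega> (Ph y) Q = \<omega> (p (Ph x) (Ph y)) c"
      by (simp add: Q_def inv1)
    finally show ?thesis
      using Z by (simp add: form_B rB rH B_simps H_simps L_def P_def Q_def c_def)
  qed
  show ?thesis
    unfolding \<phi>_def using 1 2 3 by (auto simp: dext_algebra_def)
qed

lemma \<phi>_form: "dext_form \<omega>B (\<phi> x) (\<phi> y) = \<omega> x y"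
proof -
  have "\<omega> x y = \<omega> x (Ph y) + \<omega> x (PB y) + \<omega> x (PI y)"
    by (subst (1) decomp[of y]) (simp add: w_simps)
  also have "\<omega> x (PB y) = \<omega> (PB x) (PB y)" by (simp add: w_PB_left)
  also have "\<omega> x (PI y) = - \<omega> y (Ph x)"
    using skew[of y "Ph x"] by (simp add: w_PI_right)
  finally show ?thesis
    by (simp add: \<phi>_def dext_form_def rH rB form_B)
qed

theorem is_double_extension: "is_double_extension (type_algebra p) \<omega> B \<omega>B H F G \<theta> L \<Omega>"
  unfolding is_double_extension_def isometric_isomorphic_def
  using double_extension_data \<phi>_linear \<phi>_bij \<phi>_mult \<phi>_form
  by (intro conjI exI[of _ \<phi>]) (simp_all add: type_algebra_def)

end

section \<open>Extensions by a line and by a plane\<close>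

context darboux_frame
begin

lemma inj_ii: "inj_on ii J" and inj_dd: "inj_on dd J"
  by (rule inj_onI, metis w_ii_dd zero_neq_one)+

lemma independent_ii: "independent (ii ` J)" and independent_dd: "independent (dd ` J)"
proof -
  show "independent (ii ` J)"
  proof (rule independent_if_scalars_zero)
    fix u and x assume s: "(\<Sum>x\<in>ii ` J. u x *\<^sub>R x) = 0" and "x \<in> ii ` J"
    then obtain k where k: "k \<in> J" "x = ii k" by blast
    have "0 = \<omega> (\<Sum>j\<in>J. u (ii j) *\<^sub>R ii j) (dd k)"
      using s by (simp add: sum.reindex[OF inj_ii] w_simps)
    also have "\<dots> = u (ii k)"
      using finite_J k by (simp add: w_sum_left w_simps w_ii_dd if_distrib cong: if_cong)
    finally show "u x = 0" using k by simp
  qed (simp add: finite_J)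
  show "independent (dd ` J)"
  proof (rule independent_if_scalars_zero)
    fix u and x assume s: "(\<Sum>x\<in>dd ` J. u x *\<^sub>R x) = 0" and "x \<in> dd ` J"
    then obtain k where k: "k \<in> J" "x = dd k" by blast
    have "0 = \<omega> (ii k) (\<Sum>j\<in>J. u (dd j) *\<^sub>R dd j)"
      using s by (simp add: sum.reindex[OF inj_dd] w_simps)
    also have "\<dots> = u (dd k)"
      using finite_J k by (simp add: w_sum_right w_simps w_ii_dd if_distrib cong: if_cong)
    finally show "u x = 0" using k by simp
  qed (simp add: finite_J)
qed

lemma dim_ideal: "dim ideal = card J"
  unfolding ideal_def
  by (subst dim_span_eq_card_independent[OF independent_ii]) (rule card_image[OF inj_ii])

lemma span_dd: "span (dd ` J) = {a. Ph a = a}"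
proof
  have "Real_Vector_Spaces.subspace {a. Ph a = a}"
    by (simp add: Real_Vector_Spaces.subspace_def proj_simps)
  then show "span (dd ` J) \<subseteq> {a. Ph a = a}"
    by (intro span_minimal) (auto simp: Ph_dd)
  show "{a. Ph a = a} \<subseteq> span (dd ` J)"
  proof
    fix a assume "a \<in> {a. Ph a = a}"
    moreover have "Ph a \<in> span (dd ` J)"
      unfolding Ph_def by (intro span_sum span_scale span_base) auto
    ultimately show "a \<in> span (dd ` J)" by simp
  qed
qed

lemma w_mult_self: "\<omega> (p a b) b = 0"
  using inv1[of a b b] skew[of b "p a b"] by simp

lemma Om_self: "Om a a = 0"
  by (rule form_eqI) (simp add: w_Om w_mult_self w_simps)

lemma mem_perp_ideal: "x \<in> perp \<omega> ideal \<longleftrightarrow> Ph x = 0"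
  by (simp add: perp_ideal)

end

context frame_model
begin

definition d :: "nat \<Rightarrow> 'h" where "d j = H.r (dd j)"

lemma d_closed: "j \<in> J \<Longrightarrow> d j \<in> carrier H" and sH_d: "j \<in> J \<Longrightarrow> sH (d j) = dd j"
  by (simp_all add: d_def rH Ph_dd)

lemma basis_d: "vectorspace.basis reals_ring H (d ` J)"
proof (rule H.basisI)
  have "sH ` d ` J = dd ` J" by (force simp: sH_d)
  then show "independent (sH ` d ` J)" "span (sH ` d ` J) = {a. Ph a = a}"
    by (simp_all add: independent_dd span_dd)
qed (auto simp: finite_J d_closed)

lemma FG_linear: "X \<in> carrier H \<Longrightarrow> F X \<in> linear_maps B B" "X \<in> carrier H \<Longrightarrow> G X \<in> linear_maps B B"
  using double_extension_data.F_linear[OF double_extension_data]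
    double_extension_data.G_linear[OF double_extension_data]
  by (simp_all add: bilinear_map_def)

lemma sH_expand: "X \<in> carrier H \<Longrightarrow> sH X = (\<Sum>j\<in>J. \<omega> (ii j) (sH X) *\<^sub>R dd j)"
  using sH_proj(1)[of X] by (simp add: Ph_def)

text \<open>With \<open>\<h>\<close> a line, the skew-symmetric data \<open>L\<close> and \<open>\<Omega>\<close> vanish.\<close>
theorem extension_by_line:
  assumes J: "J = {1}"
  shows "\<exists>d D \<xi> b\<^sub>0 lam. double_extension_by_line (type_algebra p) \<omega> B \<omega>B H d D \<xi> b\<^sub>0 lam"
proof -
  note One_nat_def [simp del]
  have 1: "1 \<in> J" using J by simp
  have sH: "\<exists>c. sH X = c *\<^sub>R dd 1" if "X \<in> carrier H" for X
    using sH_expand[OF that] J by auto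
  have L0: "L X Y = \<zero>\<^bsub>dual_space H\<^esub>" if "X \<in> carrier H" "Y \<in> carrier H" for X Y
  proof -
    have "\<omega> (p (sH X) (sH Y)) (sH Z) = 0" if Z: "Z \<in> carrier H" for Z
    proof -
      obtain a b where "sH Y = a *\<^sub>R dd 1" "sH Z = b *\<^sub>R dd 1"
        using sH \<open>Y \<in> carrier H\<close> Z by blast
      then show ?thesis by (simp add: p_simps w_simps w_mult_self)
    qed
    then show ?thesis by (auto simp: L_def dual_space_def restrict_def fun_eq_iff)
  qed
  have \<Omega>0: "\<Omega> X Y = \<zero>\<^bsub>B\<^esub>" if h: "X \<in> carrier H" "Y \<in> carrier H" for X Y
  proof (rule B.s_eqI)
    obtain a b where "sH X = a *\<^sub>R dd 1" "sH Y = b *\<^sub>R dd 1" using sH h by blast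
    then show "sB (\<Omega> X Y) = sB \<zero>\<^bsub>B\<^esub>"
      by (simp add: B_simps linear_scale[OF Om_lin1] linear_scale[OF Om_lin2] Om_self)
  qed (simp_all add: B_simps)
  have "Ph x = \<omega> (ii 1) x *\<^sub>R dd 1" for x
    unfolding Ph_def by (simp add: J)
  then have "d 1 \<otimes>\<^bsub>H\<^esub> d 1 = \<omega> (ii 1) (p (dd 1) (dd 1)) \<odot>\<^bsub>H\<^esub> d 1"
    by (intro H.s_eqI) (simp_all add: H_simps d_closed[OF 1] sH_d[OF 1])
  then have "double_extension_by_line (type_algebra p) \<omega> B \<omega>B H (d 1) (G (d 1)) (F (d 1)) (\<theta> (d 1) (d 1))
      (\<omega> (ii 1) (p (dd 1) (dd 1)))"
    unfolding double_extension_by_line_def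
    using basis_d FG_linear[OF d_closed[OF 1]] data_closed is_double_extension L0 \<Omega>0 J
    by (intro conjI exI[of _ F] exI[of _ G] exI[of _ \<theta>] exI[of _ L] exI[of _ \<Omega>]) auto
  then show ?thesis by blast
qed

text \<open>
  A form \<open>L (d i)\<close> that is alternating on a plane is determined by its value
  \<open>l i = L (d i) (d 1) (d 2)\<close>, and \<open>\<Omega>\<close> by \<open>\<Omega> (d 1) (d 2)\<close>.
\<close>
theorem extension_by_plane:
  assumes J: "J = {1, 2}"
  shows "\<exists>d D \<xi> a\<^sub>0 b l t s. double_extension_by_plane (type_algebra p) \<omega> B \<omega>B H d D \<xi> a\<^sub>0 b l t s"
proof -
  note One_nat_def [simp del]
  define e where "e j = (\<lambda>Z\<in>carrier H. \<omega> (ii j) (sH Z))" for j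
  define l where "l j = \<omega> (p (dd j) (dd 1)) (dd 2)" for j
  define t where "t i j = \<omega> (ii 1) (p (dd i) (dd j))" for i j
  define s where "s i j = \<omega> (ii 2) (p (dd i) (dd j))" for i j
  have J12: "1 \<in> J" "2 \<in> J" using J by simp_all
  note closed = d_closed[OF J12(1)] d_closed[OF J12(2)]
  have sHd: "sH (d 1) = dd 1" "sH (d 2) = dd 2" using J12 by (simp_all add: sH_d)
  have iJ: "i \<in> J" if "i \<in> {1, 2}" for i using that J by blast
  have "d 1 \<noteq> d 2"
    using sHd w_ii_dd[OF J12(1) J12(1)] w_ii_dd[OF J12] by auto
  moreover have "vectorspace.basis reals_ring H {d 1, d 2}"
    using basis_d J by simp
  moreover have "\<Omega> (d 1) (d 2) \<in> carrier B" by (simp add: B_simps)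
  moreover have "\<forall>i\<in>{1, 2}. G (d i) \<in> linear_maps B B \<and> F (d i) \<in> linear_maps B B"
    using FG_linear d_closed iJ by blast
  moreover have "\<forall>i\<in>{1, 2}. \<forall>j\<in>{1, 2}. \<theta> (d i) (d j) \<in> carrier B \<and> t i j = t j i \<and> s i j = s j i \<and>
      d i \<otimes>\<^bsub>H\<^esub> d j = (t i j \<odot>\<^bsub>H\<^esub> d 1) \<oplus>\<^bsub>H\<^esub> (s i j \<odot>\<^bsub>H\<^esub> d 2)"
  proof (intro ballI conjI)
    fix i j :: nat assume ij: "i \<in> {1, 2}" "j \<in> {1, 2}"
    show "\<theta> (d i) (d j) \<in> carrier B" by (simp add: B_simps)
    show "t i j = t j i" "s i j = s j i"
      by (simp_all add: t_def s_def central_part_swap[OF ii_central[OF J12(1)], of "dd i"]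
          central_part_swap[OF ii_central[OF J12(2)], of "dd i"])
    have "Ph x = \<omega> (ii 1) x *\<^sub>R dd 1 + \<omega> (ii 2) x *\<^sub>R dd 2" for x
      unfolding Ph_def by (simp add: J)
    then show "d i \<otimes>\<^bsub>H\<^esub> d j = (t i j \<odot>\<^bsub>H\<^esub> d 1) \<oplus>\<^bsub>H\<^esub> (s i j \<odot>\<^bsub>H\<^esub> d 2)"
      by (intro H.s_eqI) (simp_all add: H_simps closed d_closed[OF iJ[OF ij(1)]] d_closed[OF iJ[OF ij(2)]]
          sH_d[OF iJ[OF ij(1)]] sH_d[OF iJ[OF ij(2)]] sHd t_def s_def)
  qed
  moreover have "\<forall>j\<in>{1, 2}. e j \<in> carrier (dual_space H) \<and>
        (\<forall>k\<in>{1, 2}. e j (d k) = (if j = k then 1 else 0))"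
    using functional_in_dual by (auto simp: e_def closed sHd w_ii_dd J12)
  moreover have "\<Omega> (d 2) (d 1) = \<ominus>\<^bsub>B\<^esub> \<Omega> (d 1) (d 2)"
    by (rule B.s_eqI) (simp_all add: B_simps Om_skew[of "sH (d 2)"])
  moreover have "\<forall>i\<in>{1, 2}. \<Omega> (d i) (d i) = \<zero>\<^bsub>B\<^esub>"
    by (intro ballI B.s_eqI) (simp_all add: B_simps Om_self)
  moreover have "\<forall>i\<in>{1, 2}. L (d i) (d 1) = l i \<odot>\<^bsub>dual_space H\<^esub> e 2 \<and>
        L (d i) (d 2) = (- l i) \<odot>\<^bsub>dual_space H\<^esub> e 1"
  proof (intro ballI conjI)
    fix i :: nat assume i: "i \<in> {1, 2}"
    have sHZ: "sH Z = \<omega> (ii 1) (sH Z) *\<^sub>R dd 1 + \<omega> (ii 2) (sH Z) *\<^sub>R dd 2" if "Z \<in> carrier H" for Z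
      using sH_expand[OF that] J by simp
    have l': "\<omega> (p (dd i) (dd 2)) (dd 1) = - l i"
      using inv1[of "dd i" "dd 2" "dd 1"] skew[of "dd 2" "p (dd i) (dd 1)"] by (simp add: l_def)
    have "\<omega> (p (dd i) (dd 1)) (sH Z) = l i * \<omega> (ii 2) (sH Z)"
      "\<omega> (p (dd i) (dd 2)) (sH Z) = - l i * \<omega> (ii 1) (sH Z)" if Z: "Z \<in> carrier H" for Z
      by (subst sHZ[OF Z], simp add: w_simps w_mult_self l' l_def[symmetric])+
    then show "L (d i) (d 1) = l i \<odot>\<^bsub>dual_space H\<^esub> e 2"
      "L (d i) (d 2) = (- l i) \<odot>\<^bsub>dual_space H\<^esub> e 1"
      using sH_d[OF iJ[OF i]]
      by (auto simp: L_def dual_space_def e_def sHd restrict_def fun_eq_iff)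
  qed
  ultimately have "double_extension_by_plane (type_algebra p) \<omega> B \<omega>B H d (\<lambda>i. G (d i)) (\<lambda>i. F (d i))
      (\<Omega> (d 1) (d 2)) (\<lambda>i j. \<theta> (d i) (d j)) l t s"
    unfolding double_extension_by_plane_def
    using is_double_extension
    by (intro conjI exI[of _ F] exI[of _ G] exI[of _ \<theta>] exI[of _ L] exI[of _ \<Omega>] exI[of _ e]) blast+
  then show ?thesis by blast
qed

end

section \<open>Quotients of the algebra as concrete spaces\<close>

text \<open>
  A quotient \<open>M / K\<close> is computed in the range of a projection \<open>\<pi>\<close> of \<open>M\<close> with kernel \<open>K\<close>; the value of
  \<open>\<pi>\<close> on a coset is its value on any member.
\<close>
definition coset_value :: "('a \<Rightarrow> 'a) \<Rightarrow> 'a set \<Rightarrow> 'a" where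
  "coset_value \<pi> X = \<pi> (SOME x. x \<in> X)"

locale projected_quotient =
  fixes p :: "'a::real_vector \<Rightarrow> 'a \<Rightarrow> 'a" and M K :: "'a set" and \<pi> :: "'a \<Rightarrow> 'a"
  assumes p_lin1: "\<And>y. linear (\<lambda>x. p x y)" and p_lin2: "\<And>x. linear (p x)"
    and M: "Real_Vector_Spaces.subspace M"
    and \<pi>: "linear \<pi>" and \<pi>_\<pi>: "\<And>x. \<pi> (\<pi> x) = \<pi> x" and \<pi>_M: "\<And>x. \<pi> x \<in> M"
    and K_iff: "\<And>x. x \<in> K \<longleftrightarrow> x \<in> M \<and> \<pi> x = 0"
    and mult_M: "\<And>x y. x \<in> M \<Longrightarrow> y \<in> M \<Longrightarrow> p x y \<in> M"
    and mult_K1: "\<And>x y. x \<in> K \<Longrightarrow> y \<in> M \<Longrightarrow> \<pi> (p x y) = 0"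
    and mult_K2: "\<And>x y. x \<in> M \<Longrightarrow> y \<in> K \<Longrightarrow> \<pi> (p x y) = 0"
begin

abbreviation A :: "(real, 'a) module" where "A \<equiv> (type_algebra p)\<lparr>carrier := M\<rparr>"
abbreviation Q :: "(real, 'a set) module" where "Q \<equiv> quotient_algebra A K"

definition coset :: "'a \<Rightarrow> 'a set" where "coset x = {y \<in> M. \<pi> y = \<pi> x}"

lemma a_r_coset_eq: "x \<in> M \<Longrightarrow> K +>\<^bsub>A\<^esub> x = coset x"
proof -
  assume x: "x \<in> M"
  have "K +>\<^bsub>A\<^esub> x = (\<lambda>k. k + x) ` K"
    by (auto simp: a_r_coset_def' type_algebra_def)
  also have "\<dots> = coset x"
  proof
    show "(\<lambda>k. k + x) ` K \<subseteq> coset x"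
      using x M by (auto simp: coset_def K_iff linear_add[OF \<pi>] subspace_add)
    show "coset x \<subseteq> (\<lambda>k. k + x) ` K"
    proof
      fix y assume "y \<in> coset x"
      then have "y - x \<in> K" "y = (y - x) + x"
        using x M by (auto simp: coset_def K_iff linear_diff[OF \<pi>] subspace_diff)
      then show "y \<in> (\<lambda>k. k + x) ` K" by blast
    qed
  qed
  finally show ?thesis .
qed

lemma mem_coset: "x \<in> M \<Longrightarrow> x \<in> coset x"
  by (simp add: coset_def)

lemma coset_value_coset: "x \<in> M \<Longrightarrow> coset_value \<pi> (coset x) = \<pi> x"
  unfolding coset_value_def using someI[of "\<lambda>y. y \<in> coset x", OF mem_coset] by (simp add: coset_def)

lemma carrier_Q: "carrier Q = coset ` M"
  by (auto simp: quotient_algebra_def A_RCOSETS_def' a_r_coset_eq)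

lemma carrier_QE: "X \<in> carrier Q \<Longrightarrow> (\<And>x. x \<in> M \<Longrightarrow> X = coset x \<Longrightarrow> thesis) \<Longrightarrow> thesis"
  unfolding carrier_Q by blast

lemma add_Q: "x \<in> M \<Longrightarrow> y \<in> M \<Longrightarrow> coset x \<oplus>\<^bsub>Q\<^esub> coset y = coset (x + y)"
proof -
  assume x: "x \<in> M" and y: "y \<in> M"
  have "coset (x + y) \<subseteq> (\<Union>a\<in>coset x. \<Union>b\<in>coset y. {a + b})"
  proof
    fix z assume z: "z \<in> coset (x + y)"
    then have "z - y \<in> coset x" using y M by (simp add: coset_def linear_diff[OF \<pi>] linear_add[OF \<pi>] subspace_diff)
    moreover have "z = (z - y) + y" by simp
    ultimately show "z \<in> (\<Union>a\<in>coset x. \<Union>b\<in>coset y. {a + b})" using mem_coset[OF y] by blast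
  qed
  then show ?thesis
    using M by (auto simp: quotient_algebra_def set_add_def' type_algebra_def coset_def linear_add[OF \<pi>] subspace_add)
qed

lemma smult_Q: "x \<in> M \<Longrightarrow> c \<odot>\<^bsub>Q\<^esub> coset x = coset (c *\<^sub>R x)"
proof -
  assume x: "x \<in> M"
  have "c \<odot>\<^bsub>Q\<^esub> coset x = (\<Union>a\<in>coset x. K +>\<^bsub>A\<^esub> (c *\<^sub>R a))"
    by (simp add: quotient_algebra_def type_algebra_def)
  also have "\<dots> = (\<Union>a\<in>coset x. coset (c *\<^sub>R x))"
    using M by (intro SUP_cong refl) (simp add: coset_def a_r_coset_eq subspace_scale linear_scale[OF \<pi>])
  finally show ?thesis using mem_coset[OF x] by auto
qed

lemma mult_Q: "x \<in> M \<Longrightarrow> y \<in> M \<Longrightarrow> coset x \<otimes>\<^bsub>Q\<^esub> coset y = coset (p x y)"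
proof -
  assume x: "x \<in> M" and y: "y \<in> M"
  have *: "K +>\<^bsub>A\<^esub> p a b = coset (p x y)" if "a \<in> coset x" "b \<in> coset y" for a b
  proof -
    have ab: "a \<in> M" "b \<in> M" "a - x \<in> K" "b - y \<in> K"
      using that x y M by (auto simp: coset_def K_iff subspace_diff linear_diff[OF \<pi>])
    have "p a b = p x y + p (a - x) b + p x (b - y)"
      by (simp add: linear_diff[OF p_lin1] linear_diff[OF p_lin2])
    then have "\<pi> (p a b) = \<pi> (p x y)"
      using mult_K1[OF ab(3,2)] mult_K2[OF x ab(4)] by (simp add: linear_add[OF \<pi>])
    then show ?thesis using ab mult_M by (simp add: a_r_coset_eq) (simp add: coset_def)
  qed
  have "coset x \<otimes>\<^bsub>Q\<^esub> coset y = (\<Union>a\<in>coset x. \<Union>b\<in>coset y. K +>\<^bsub>A\<^esub> p a b)"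
    by (simp add: quotient_algebra_def rcoset_mult_def type_algebra_def)
  also have "\<dots> = coset (p x y)" using * mem_coset[OF x] mem_coset[OF y] by auto
  finally show ?thesis .
qed

lemma zero_Q: "\<zero>\<^bsub>Q\<^esub> = coset 0"
  by (auto simp: quotient_algebra_def coset_def K_iff linear_0[OF \<pi>])

lemma concrete_space_Q: "concrete_space Q (coset_value \<pi>) {u. \<pi> u = u}"
proof
  have "inj_on (coset_value \<pi>) (carrier Q)"
    by (rule inj_onI) (auto elim!: carrier_QE simp: coset_value_coset, auto simp: coset_def)
  moreover have "coset_value \<pi> ` carrier Q = {u. \<pi> u = u}"
  proof
    show "coset_value \<pi> ` carrier Q \<subseteq> {u. \<pi> u = u}"
      by (auto elim!: carrier_QE simp: coset_value_coset \<pi>_\<pi>)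
    show "{u. \<pi> u = u} \<subseteq> coset_value \<pi> ` carrier Q"
    proof
      fix u assume "u \<in> {u. \<pi> u = u}"
      then have "\<pi> u = u" by simp
      then have "u = coset_value \<pi> (coset u)" "coset u \<in> carrier Q"
        using \<pi>_M[of u] by (simp_all add: coset_value_coset carrier_Q)
      then show "u \<in> coset_value \<pi> ` carrier Q" by blast
    qed
  qed
  ultimately show "bij_betw (coset_value \<pi>) (carrier Q) {u. \<pi> u = u}"
    by (simp add: bij_betw_def)
  have "0 \<in> M" using M by (rule subspace_0)
  then show "\<zero>\<^bsub>Q\<^esub> \<in> carrier Q" "coset_value \<pi> \<zero>\<^bsub>Q\<^esub> = 0"
    by (simp_all add: zero_Q carrier_Q coset_value_coset linear_0[OF \<pi>])
  fix X Y :: "'a set" and c :: real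
  assume X: "X \<in> carrier Q"
  then show "c \<odot>\<^bsub>Q\<^esub> X \<in> carrier Q" "coset_value \<pi> (c \<odot>\<^bsub>Q\<^esub> X) = c *\<^sub>R coset_value \<pi> X"
    using M by (auto elim!: carrier_QE simp: smult_Q coset_value_coset linear_scale[OF \<pi>] subspace_scale)
      (auto simp: carrier_Q subspace_scale)
  assume "Y \<in> carrier Q"
  with X show "X \<oplus>\<^bsub>Q\<^esub> Y \<in> carrier Q" "coset_value \<pi> (X \<oplus>\<^bsub>Q\<^esub> Y) = coset_value \<pi> X + coset_value \<pi> Y"
    using M by (auto elim!: carrier_QE simp: add_Q coset_value_coset linear_add[OF \<pi>] subspace_add)
      (auto simp: carrier_Q subspace_add)
qed

lemma mult_Q_closed: "X \<in> carrier Q \<Longrightarrow> Y \<in> carrier Q \<Longrightarrow> X \<otimes>\<^bsub>Q\<^esub> Y \<in> carrier Q"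
  by (auto elim!: carrier_QE simp: mult_Q) (auto simp: carrier_Q mult_M)

lemma coset_value_mult:
  assumes "X \<in> carrier Q" "Y \<in> carrier Q"
  shows "coset_value \<pi> (X \<otimes>\<^bsub>Q\<^esub> Y) = \<pi> (p (coset_value \<pi> X) (coset_value \<pi> Y))"
proof -
  obtain x y where xy: "x \<in> M" "y \<in> M" "X = coset x" "Y = coset y"
    using assms by (auto elim!: carrier_QE)
  have "coset x = coset (\<pi> x)" "coset y = coset (\<pi> y)" by (simp_all add: coset_def \<pi>_\<pi>)
  then have "X \<otimes>\<^bsub>Q\<^esub> Y = coset (p (\<pi> x) (\<pi> y))"
    using xy mult_Q[OF \<pi>_M \<pi>_M, of x y] by simp
  then show ?thesis using xy by (simp add: coset_value_coset mult_M \<pi>_M)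
qed

end

context balanced_frame
begin

lemma projected_quotient_B: "projected_quotient p (perp \<omega> ideal) ideal PB"
proof (rule projected_quotient.intro)
  show "p x y \<in> perp \<omega> ideal" if "x \<in> perp \<omega> ideal" "y \<in> perp \<omega> ideal" for x y
    using that by (simp add: mem_perp_ideal Ph_mult_left)
  show "PB (p x y) = 0" if "x \<in> ideal" for x y
    using PI_ideal[OF that] p_PI_left[of x y] by (simp add: proj_simps)
  show "PB (p x y) = 0" if "y \<in> ideal" for x y
    using ideal_mult[OF that] by (rule PB_ideal)
qed (auto simp: p_lin1 p_lin2 subspace_perp PB_lin mem_perp_ideal ideal_iff)

lemma projected_quotient_H: "projected_quotient p UNIV (perp \<omega> ideal) Ph"
  by (rule projected_quotient.intro)
    (auto simp: p_lin1 p_lin2 Ph_lin mem_perp_ideal Ph_mult_left Ph_mult_right)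

lemma type_algebra_carrier: "(type_algebra p)\<lparr>carrier := UNIV\<rparr> = type_algebra p"
  by (simp add: type_algebra_def)

lemma frame_model_quotients:
  "frame_model p \<omega> J dd ii (perp_quotient p \<omega> ideal) (coset_value PB)
    (quotient_by_perp p \<omega> ideal) (coset_value Ph) (quotient_form \<omega>)"
proof -
  interpret QB: projected_quotient p "perp \<omega> ideal" ideal PB by (rule projected_quotient_B)
  interpret QH: projected_quotient p UNIV "perp \<omega> ideal" Ph by (rule projected_quotient_H)
  have B: "perp_quotient p \<omega> ideal = QB.Q" by (simp add: perp_quotient_def)
  have H: "quotient_by_perp p \<omega> ideal = QH.Q" by (simp add: quotient_by_perp_def type_algebra_carrier)
  have form: "quotient_form \<omega> X Y = \<omega> (coset_value PB X) (coset_value PB Y)"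
    if XY: "X \<in> carrier QB.Q" "Y \<in> carrier QB.Q" for X Y
  proof -
    obtain x y where xy: "x \<in> perp \<omega> ideal" "y \<in> perp \<omega> ideal" "X = QB.coset x" "Y = QB.coset y"
      using XY by (auto elim!: QB.carrier_QE)
    have "\<omega> a b = \<omega> (PB x) (PB y)" if "a \<in> X" "b \<in> Y" for a b
    proof -
      have ab: "Ph a = 0" "Ph b = 0" "PB a = PB x" "PB b = PB y"
        using that xy by (auto simp: QB.coset_def mem_perp_ideal)
      have "\<omega> (PB a) (PB b) = \<omega> a b" unfolding w_PB_left using ab(1,2) by (simp add: w_PB_right w_simps)
      with ab show ?thesis by simp
    qed
    then have "{\<omega> a b | a b. a \<in> X \<and> b \<in> Y} = {\<omega> (PB x) (PB y)}"
      using QB.mem_coset[OF xy(1)] QB.mem_coset[OF xy(2)] xy(3,4) by auto metis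
    then show ?thesis
      using xy by (simp add: quotient_form_def QB.coset_value_coset)
  qed
  show ?thesis
    unfolding B H
    by (intro frame_model.intro balanced_frame_axioms QB.concrete_space_Q QH.concrete_space_Q
        frame_model_axioms.intro QB.mult_Q_closed QB.coset_value_mult QH.mult_Q_closed
        QH.coset_value_mult form)
qed

lemma two_sided_ideal_ideal: "two_sided_ideal p ideal"
  unfolding two_sided_ideal_def
proof (intro conjI ballI allI)
  show "Real_Vector_Spaces.subspace ideal" by (simp add: ideal_def)
  fix x y assume "x \<in> ideal"
  then show "p x y \<in> ideal" "p y x \<in> ideal"
    using PI_ideal[of x] p_PI_left[of x y] ideal_mult by (simp_all add: ideal_iff proj_simps)
qed

end

theorem theorem6p7:
  fixes p :: "'a::real_vector \<Rightarrow> 'a \<Rightarrow> 'a" and \<omega> :: "'a \<Rightarrow> 'a \<Rightarrow> real"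
  assumes "pre_symplectic_lsa (type_algebra p) \<omega>"
    and "degenerate \<omega> (commutator_ideal p)"
  shows "\<exists>I. two_sided_ideal p I \<and> totally_isotropic \<omega> I \<and>
    I \<subseteq> commutator_ideal p \<inter> perp \<omega> (commutator_ideal p) \<and>
    (dim I = 1 \<or> dim I = 2) \<and>
    ((\<exists>d D \<xi> b\<^sub>0 lam.
        double_extension_by_line (type_algebra p) \<omega>
          (perp_quotient p \<omega> I) (quotient_form \<omega>) (quotient_by_perp p \<omega> I) d D \<xi> b\<^sub>0 lam) \<or>
     (\<exists>d D \<xi> a\<^sub>0 b l t s.
        double_extension_by_plane (type_algebra p) \<omega>
          (perp_quotient p \<omega> I) (quotient_form \<omega>) (quotient_by_perp p \<omega> I) d D \<xi> a\<^sub>0 b l t s))"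
proof -
  interpret psl_algebra p \<omega> by (rule psl_algebra_if_pre_symplectic_lsa[OF assms(1)])
  obtain J dd ii where J: "J = {1} \<or> J = {1, 2}" and frame: "balanced_frame p \<omega> J dd ii"
    using balanced_frame_exists[OF assms(2)] by blast
  interpret balanced_frame p \<omega> J dd ii by (rule frame)
  interpret frame_model p \<omega> J dd ii "perp_quotient p \<omega> ideal" "coset_value PB"
    "quotient_by_perp p \<omega> ideal" "coset_value Ph" "quotient_form \<omega>"
    by (rule frame_model_quotients)
  have "dim ideal = 1 \<or> dim ideal = 2"
    using J by (auto simp: dim_ideal)
  moreover have "ideal \<subseteq> commutator_ideal p \<inter> perp \<omega> (commutator_ideal p)"
    using ideal_central by (auto simp: central_part_def)
  moreover have "totally_isotropic \<omega> ideal"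
    using ideal_subset_perp by (simp add: totally_isotropic_def)
  ultimately show ?thesis
    using two_sided_ideal_ideal extension_by_line extension_by_plane J
    by (intro exI[of _ ideal]) blast
qed

end
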